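(* Let $(X_1,Y_1),(X_2,Y_2),\dots$ be a random sample (i.i.d. copies) of a random vector $(X,Y)$ with continuous joint distribution function $H$, marginal distribution functions $F$ and $G$, and (unique) copula $A$. Assume that $A$ allows a continuous Markov kernel $K_A$ and define $K_H(x,(-\infty,y]):=K_A(F(x),[0,G(y)])$ for $x,y\in\mathbb{R}$. Let $F_n,G_n$ be the univariate empirical distribution functions and $E_n$ the empirical copula of $(X_1,Y_1),\dots,(X_n,Y_n)$, and set $N(n):=\lfloor n^s\rfloor$ for some $s\in(0,\tfrac12)$. Then, almost surely, $$\lim_{n\to\infty}\sup_{(x,y)\in\mathbb{R}^2}\left|K_{\mathcal{B}_{N(n)}(E_n)}(F_n(x),[0,G_n(y)])-K_H(x,(-\infty,y])\right|=0.$$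
   Context: A (bivariate) copula is a distribution function on $[0,1]^2$ with uniform marginals; each copula $B$ corresponds to a doubly stochastic measure $\mu_B$ with $B(x,y)=\mu_B([0,x]\times[0,y])$. A Markov kernel of a copula $B$ is a map $K_B:[0,1]\times\mathcal{B}([0,1])\to[0,1]$, measurable in the first argument, a probability measure in the second, with $\int_{E_1}K_B(x,E_2)\,d\lambda(x)=\mu_B(E_1\times E_2)$ for all Borel $E_1,E_2\subseteq[0,1]$. A copula $A$ allows a continuous Markov kernel if it has a version $K_A$ such that $(x,y)\mapsto K_A(x,[0,y])$ is continuous on $[0,1]^2$; $K_A$ denotes this version. Bernstein approximation: $p_{N,k}(u)=\binom Nk u^k(1-u)^{N-k}$ for $k\in\{0,\dots,N\}$ and $p_{N,k}\equiv0$ otherwise; for a copula $B$, $\mathcal{B}_N(B)(x,y)=\sum_{i,j=1}^N B(\tfrac iN,\tfrac jN)p_{N,i}(x)p_{N,j}(y)$, with Markov kernel version $K_{\mathcal{B}_N(B)}(x,[0,y])=N\sum_{i,j=1}^N B(\tfrac iN,\tfrac jN)\big(p_{N-1,i-1}(x)-p_{N-1,i}(x)\big)p_{N,j}(y)$, $(x,y)\in[0,1]^2$. Empirical copula: with $H_n$ the bivariate empirical distribution function of the first $n$ observations, almost surely there is a unique subcopula $E_n'$ on $\{0,\tfrac1n,\dots,1\}^2$ with $H_n(x,y)=E_n'(F_n(x),G_n(y))$; $E_n$ is the copula extending $E_n'$ by bilinear interpolation on each square $[\tfrac{i-1}n,\tfrac in]\times[\tfrac{j-1}n,\tfrac jn]$.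 *)

theory Defs
  imports "HOL-Probability.Probability"
begin

definition bern :: "nat \<Rightarrow> nat \<Rightarrow> real \<Rightarrow> real" where
  "bern N k u = (if k \<le> N then real (N choose k) * u ^ k * (1 - u) ^ (N - k) else 0)"

text \<open>The version K_{B_N(B)}(x,[0,y]) of the Markov kernel of the Bernstein approximation.\<close>
definition bernstein_kernel :: "nat \<Rightarrow> (real \<Rightarrow> real \<Rightarrow> real) \<Rightarrow> real \<Rightarrow> real \<Rightarrow> real" where
  "bernstein_kernel N B x y =
     real N * (\<Sum>i=1..N. \<Sum>j=1..N.
        B (real i / real N) (real j / real N) *
        (bern (N - 1) (i - 1) x - bern (N - 1) i x) * bern N j y)"

definition doubly_stochastic_measure_of :: "(real \<Rightarrow> real \<Rightarrow> real) \<Rightarrow> (real \<times> real) measure \<Rightarrow> bool" where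
  "doubly_stochastic_measure_of B \<mu> \<longleftrightarrow>
     prob_space \<mu> \<and> sets \<mu> = sets (borel :: (real \<times> real) measure) \<and>
     emeasure \<mu> ({0..1} \<times> {0..1}) = 1 \<and>
     (\<forall>x\<in>{0..1}. measure \<mu> ({0..x} \<times> {0..1}) = x \<and> measure \<mu> ({0..1} \<times> {0..x}) = x) \<and>
     (\<forall>x\<in>{0..1}. \<forall>y\<in>{0..1}. measure \<mu> ({0..x} \<times> {0..y}) = B x y)"

definition copula :: "(real \<Rightarrow> real \<Rightarrow> real) \<Rightarrow> bool" where
  "copula B \<longleftrightarrow> (\<exists>\<mu>. doubly_stochastic_measure_of B \<mu>)"

definition markov_kernel_of :: "(real \<Rightarrow> real \<Rightarrow> real) \<Rightarrow> (real \<Rightarrow> real measure) \<Rightarrow> bool" where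
  "markov_kernel_of B K \<longleftrightarrow>
     (\<forall>x\<in>{0..1}. prob_space (K x) \<and> sets (K x) = sets (restrict_space borel {0..1::real})) \<and>
     (\<forall>E\<in>sets (restrict_space borel {0..1::real}).
        (\<lambda>x. measure (K x) E) \<in> borel_measurable (restrict_space borel {0..1::real})) \<and>
     (\<exists>\<mu>. doubly_stochastic_measure_of B \<mu> \<and>
        (\<forall>E1\<in>sets (restrict_space borel {0..1::real}). \<forall>E2\<in>sets (restrict_space borel {0..1::real}).
           (\<integral>\<^sup>+x\<in>E1. emeasure (K x) E2 \<partial>lborel) = emeasure \<mu> (E1 \<times> E2)))"

definition continuous_markov_kernel_of :: "(real \<Rightarrow> real \<Rightarrow> real) \<Rightarrow> (real \<Rightarrow> real measure) \<Rightarrow> bool" where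
  "continuous_markov_kernel_of B K \<longleftrightarrow>
     markov_kernel_of B K \<and>
     continuous_on ({0..1} \<times> {0..1}) (\<lambda>(x, y). measure (K x) {0..y})"

definition emp_cdf :: "(nat \<Rightarrow> 'a \<Rightarrow> real) \<Rightarrow> nat \<Rightarrow> 'a \<Rightarrow> real \<Rightarrow> real" where
  "emp_cdf X n \<omega> x = real (card {k\<in>{..<n}. X k \<omega> \<le> x}) / real n"

definition emp_joint :: "(nat \<Rightarrow> 'a \<Rightarrow> real) \<Rightarrow> (nat \<Rightarrow> 'a \<Rightarrow> real) \<Rightarrow> nat \<Rightarrow> 'a \<Rightarrow> real \<Rightarrow> real \<Rightarrow> real" where
  "emp_joint X Y n \<omega> x y = real (card {k\<in>{..<n}. X k \<omega> \<le> x \<and> Y k \<omega> \<le> y}) / real n"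

text \<open>A subcopula on the grid {0,1/n,...,1}^2, encoded by its values E i j at (i/n, j/n)
  (and 0 off the grid indices).\<close>
definition grid_subcopula :: "nat \<Rightarrow> (nat \<Rightarrow> nat \<Rightarrow> real) \<Rightarrow> bool" where
  "grid_subcopula n E \<longleftrightarrow>
     (\<forall>i j. (n < i \<or> n < j) \<longrightarrow> E i j = 0) \<and>
     (\<forall>i\<le>n. E i 0 = 0 \<and> E 0 i = 0 \<and> E i n = real i / real n \<and> E n i = real i / real n) \<and>
     (\<forall>i1 i2 j1 j2. i1 \<le> i2 \<and> i2 \<le> n \<and> j1 \<le> j2 \<and> j2 \<le> n \<longrightarrow>
        E i2 j2 - E i1 j2 - E i2 j1 + E i1 j1 \<ge> 0)"

text \<open>E'_n: the subcopula with H_n(x,y) = E'_n(F_n(x), G_n(y)); since F_n(x) = i/n with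
  i = #{k<n. X_k <= x}, the value E'_n(F_n x, G_n y) is E i j for these counts.\<close>
definition emp_subcopula :: "(nat \<Rightarrow> 'a \<Rightarrow> real) \<Rightarrow> (nat \<Rightarrow> 'a \<Rightarrow> real) \<Rightarrow> nat \<Rightarrow> 'a \<Rightarrow> nat \<Rightarrow> nat \<Rightarrow> real" where
  "emp_subcopula X Y n \<omega> = (THE E. grid_subcopula n E \<and>
      (\<forall>x y. emp_joint X Y n \<omega> x y =
             E (card {k\<in>{..<n}. X k \<omega> \<le> x}) (card {k\<in>{..<n}. Y k \<omega> \<le> y})))"

text \<open>Bilinear interpolation of grid values on each square [(i-1)/n,i/n] x [(j-1)/n,j/n]
  (meaningful for (u,v) in [0,1]^2 and n >= 1).\<close>
definition bilinear_ext :: "nat \<Rightarrow> (nat \<Rightarrow> nat \<Rightarrow> real) \<Rightarrow> real \<Rightarrow> real \<Rightarrow> real" where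
  "bilinear_ext n E u v =
     (let i = nat (min (int n - 1) \<lfloor>real n * u\<rfloor>);
          j = nat (min (int n - 1) \<lfloor>real n * v\<rfloor>);
          a = real n * u - real i;
          b = real n * v - real j
      in (1 - a) * (1 - b) * E i j + a * (1 - b) * E (i + 1) j
         + (1 - a) * b * E i (j + 1) + a * b * E (i + 1) (j + 1))"

definition emp_copula :: "(nat \<Rightarrow> 'a \<Rightarrow> real) \<Rightarrow> (nat \<Rightarrow> 'a \<Rightarrow> real) \<Rightarrow> nat \<Rightarrow> 'a \<Rightarrow> real \<Rightarrow> real \<Rightarrow> real" where
  "emp_copula X Y n \<omega> = bilinear_ext n (emp_subcopula X Y n \<omega>)"

end

theory Submission
  imports Defs "HOL-Real_Asymp.Real_Asymp"
begin

text \<open>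
  Summation by parts writes the Bernstein kernel of a copula as a Bernstein-weighted mean of the
  difference quotients \<open>N * (A ((i + 1) / N) (j / N) - A (i / N) (j / N))\<close>, which are averages of
  the kernel over \<open>[i / N, (i + 1) / N]\<close>. Chebyshev's inequality and uniform continuity hence give
  uniform convergence of the Bernstein kernels of \<open>A\<close> itself. Replacing \<open>A\<close> by the empirical copula
  costs at most \<open>2 * N\<close> times the uniform distance of the copulas, which is controlled by the
  uniform distance of the empirical distribution functions from the true ones. Hoeffding's
  inequality on an \<open>n \<times> n\<close> grid of quantiles and Borel--Cantelli bound the latter by
  \<open>n powr - r + 2 / n\<close> for any \<open>r < 1 / 2\<close>; with \<open>s < r\<close> this beats the factor \<open>N \<le> n powr s\<close>.
\<close>

section \<open>Bernstein kernels of copulas\<close>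

text \<open>The kernel formula multiplies differences of Bernstein polynomials by N, so closeness of
  copulas passes to their kernels only at the price of a factor of order N. Empirical distribution
  functions deviate at order \<open>n powr (-1/2)\<close>, hence the range s < 1/2. The error has
  three parts: the Bernstein kernel of E_n against that of A, the Bernstein kernel of A against K,
  and K at (F_n x, G_n y) against K at (F x, G y). The middle part is deterministic and uniform in
  its arguments, so random arguments do no harm there. A second obstacle is the definite description
  in \<open>emp_subcopula\<close>: it determines a value only when exactly one subcopula qualifies.
  Absence of ties guarantees this, and continuity of H excludes ties almost surely; ranks then
  supply the subcopula explicitly. Finally, deviations over all quadrants form an uncountable
  family, which bracketing reduces to finitely many measurable events for each n.\<close>

lemma bern_eq_Bernstein: "bern N k u = Bernstein N k u"
  by (simp add: bern_def Bernstein_def)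

text \<open>This is the binomial variance, the input for Chebyshev's inequality. The square is split
  into multiples of k (k - 1), k and 1, the three moments with known Bernstein sums.\<close>

lemma sum_Bernstein_variance:
  "(\<Sum>k\<le>n. (real k - real n * x)\<^sup>2 * Bernstein n k x) = real n * x * (1 - x)"
proof -
  have *: "(a - b)\<^sup>2 * c = a * (a - 1) * c + (1 - 2 * b) * (a * c) + b * b * c" for a b c :: real
    by (simp add: algebra_simps power2_eq_square)
  have "(\<Sum>k\<le>n. (real k - real n * x)\<^sup>2 * Bernstein n k x) =
      (\<Sum>k\<le>n. real k * (real k - 1) * Bernstein n k x) +
      (1 - 2 * (real n * x)) * (\<Sum>k\<le>n. real k * Bernstein n k x) +
      real n * x * (real n * x) * (\<Sum>k\<le>n. Bernstein n k x)"
    unfolding * sum.distrib sum_distrib_left by (simp only: mult.assoc)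
  then show ?thesis
    unfolding sum_Bernstein sum_k_Bernstein sum_kk_Bernstein by (simp add: algebra_simps power2_eq_square)
qed

lemma sum_Bernstein_variance_le:
  assumes "0 \<le> x" "x \<le> 1"
  shows "(\<Sum>k\<le>n. (real k - real n * x)\<^sup>2 * Bernstein n k x) \<le> real n / 4"
proof -
  have "x * (1 - x) \<le> 1 / 4"
    using zero_le_power2[of "x - 1 / 2"] by (simp add: power2_eq_square algebra_simps)
  then have "real n * (x * (1 - x)) \<le> real n * (1 / 4)" by (intro mult_left_mono) auto
  then show ?thesis by (simp add: sum_Bernstein_variance mult.assoc)
qed

lemma sum_diff_by_parts:
  fixes b q :: "nat \<Rightarrow> real"
  shows "(\<Sum>i=1..Suc m. b i * (q (i - 1) - q i)) =
    (\<Sum>i\<le>m. (b (Suc i) - b i) * q i) + b 0 * q 0 - b (Suc m) * q (Suc m)"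
  by (induction m) (auto simp: algebra_simps)

text \<open>The difference moves from the Bernstein polynomials to \<open>B\<close>. For a copula
  the coefficients become difference quotients with values in [0, 1]. Since \<open>B\<close>
  vanishes on the axes, the index j = 0 can be added, and the weights become a product of two full
  binomial distributions, of degrees m and m + 1.\<close>

lemma bernstein_kernel_by_parts:
  assumes "\<And>j. j \<le> Suc m \<Longrightarrow> B 0 (real j / real (Suc m)) = 0"
    and "\<And>i. i \<le> Suc m \<Longrightarrow> B (real i / real (Suc m)) 0 = 0"
  shows "bernstein_kernel (Suc m) B x y =
    (\<Sum>i\<le>m. \<Sum>j\<le>Suc m. real (Suc m) *
       (B (real (Suc i) / real (Suc m)) (real j / real (Suc m)) -
        B (real i / real (Suc m)) (real j / real (Suc m))) *
       (Bernstein m i x * Bernstein (Suc m) j y))"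
proof -
  define b where "b i j = B (real i / real (Suc m)) (real j / real (Suc m))" for i j
  define q where "q i = Bernstein m i x" for i
  define r where "r j = Bernstein (Suc m) j y" for j
  have b0: "b 0 j = 0" if "j \<le> Suc m" for j using assms(1)[OF that] by (simp add: b_def)
  have b0': "b i 0 = 0" if "i \<le> Suc m" for i using assms(2)[OF that] by (simp add: b_def)
  \<comment> \<open>The binomial coefficient \<open>m choose Suc m\<close> is 0, which removes the
    upper boundary term; the lower one goes with \<open>b 0 j = 0\<close>.\<close>
  have q: "q (Suc m) = 0" by (simp add: q_def Bernstein_def)
  have parts: "(\<Sum>i=1..Suc m. b i j * (q (i - 1) - q i)) = (\<Sum>i\<le>m. (b (Suc i) j - b i j) * q i)"
    if "j \<le> Suc m" for j
    using sum_diff_by_parts[of "\<lambda>i. b i j" q m] b0[OF that] q by (simp del: sum.cl_ivl_Suc)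
  have "bernstein_kernel (Suc m) B x y =
      real (Suc m) * (\<Sum>i=1..Suc m. \<Sum>j=1..Suc m. b i j * (q (i - 1) - q i) * r j)"
    by (simp only: bernstein_kernel_def bern_eq_Bernstein b_def q_def r_def diff_Suc_1)
  also have "(\<Sum>i=1..Suc m. \<Sum>j=1..Suc m. b i j * (q (i - 1) - q i) * r j) =
      (\<Sum>j=1..Suc m. (\<Sum>i=1..Suc m. b i j * (q (i - 1) - q i)) * r j)"
    by (subst sum.swap) (simp only: sum_distrib_right)
  also have "\<dots> = (\<Sum>j=1..Suc m. (\<Sum>i\<le>m. (b (Suc i) j - b i j) * q i) * r j)"
    by (intro sum.cong refl) (simp only: parts atLeastAtMost_iff)
  also have "\<dots> = (\<Sum>j\<le>Suc m. (\<Sum>i\<le>m. (b (Suc i) j - b i j) * q i) * r j)"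
    by (intro sum.mono_neutral_left) (auto simp: b0' not_less_eq_eq)
  also have "real (Suc m) * \<dots> =
      (\<Sum>i\<le>m. \<Sum>j\<le>Suc m. real (Suc m) * (b (Suc i) j - b i j) * (q i * r j))"
    unfolding sum_distrib_left sum_distrib_right by (subst sum.swap) (simp only: mult_ac)
  finally show ?thesis by (simp only: b_def q_def r_def)
qed

text \<open>Stated for arbitrary functions, because the empirical copula enters only through its
  distance from A on the grid. Cancellation in \<open>q (i - 1) - q i\<close> is given up in favour
  of the sum \<open>q (i - 1) + q i\<close>; each of the two families has total at most 1, which is
  the origin of the factor 2.\<close>

lemma bernstein_kernel_diff_le:
  assumes N: "0 < N" and x: "x \<in> {0..1}" and y: "y \<in> {0..1}"
    and BC: "\<And>i j. i \<le> N \<Longrightarrow> j \<le> N \<Longrightarrow>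
      \<bar>B (real i / real N) (real j / real N) - C (real i / real N) (real j / real N)\<bar> \<le> d"
  shows "\<bar>bernstein_kernel N B x y - bernstein_kernel N C x y\<bar> \<le> 2 * real N * d"
proof -
  define D where "D i j = B (real i / real N) (real j / real N) - C (real i / real N) (real j / real N)" for i j :: nat
  define q where "q i = Bernstein (N - 1) i x" for i
  define r where "r j = Bernstein N j y" for j
  have q: "0 \<le> q i" and r: "0 \<le> r i" for i
    using x y by (auto simp: q_def r_def Bernstein_nonneg)
  have d: "0 \<le> d" using BC[of 0 0] by auto
  have D: "\<bar>D i j\<bar> \<le> d" if "i \<le> N" "j \<le> N" for i j
    using BC[OF that] by (simp add: D_def)
  have "bernstein_kernel N B x y - bernstein_kernel N C x y =
      real N * (\<Sum>i=1..N. \<Sum>j=1..N. D i j * (q (i - 1) - q i) * r j)"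
    by (simp add: bernstein_kernel_def bern_eq_Bernstein D_def q_def r_def
        flip: right_diff_distrib sum_subtractf left_diff_distrib)
  also have "\<bar>\<dots>\<bar> \<le> real N * (\<Sum>i=1..N. \<Sum>j=1..N. d * (q (i - 1) + q i) * r j)"
  proof -
    have "\<bar>D i j * (q (i - 1) - q i) * r j\<bar> \<le> d * (q (i - 1) + q i) * r j"
      if "i \<in> {1..N}" "j \<in> {1..N}" for i j
      unfolding abs_mult
      using that q[of i] q[of "i - 1"] r[of j] D[of i j] d by (intro mult_mono) auto
    then show ?thesis
      unfolding abs_mult[of "real N"]
      by (intro mult_mono order.trans[OF sum_abs] sum_mono) auto
  qed
  also have "\<dots> = real N * d * ((\<Sum>i=1..N. q (i - 1)) + (\<Sum>i=1..N. q i)) * (\<Sum>j=1..N. r j)"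
    by (simp add: sum_distrib_left sum_distrib_right sum.distrib[symmetric] algebra_simps)
  also have "\<dots> \<le> real N * d * (1 + 1) * 1"
  proof -
    obtain m where m: "N = Suc m" using N by (cases N) auto
    have "(\<Sum>i=1..N. q (i - 1)) = (\<Sum>i\<le>m. q i)"
      using sum.atLeast_Suc_atMost_Suc_shift[of "\<lambda>i. q (i - 1)" 0 m]
      by (simp add: m atMost_atLeast0 o_def del: sum.cl_ivl_Suc)
    also have "\<dots> = 1" by (simp add: q_def m)
    finally have 1: "(\<Sum>i=1..N. q (i - 1)) = 1" .
    have "(\<Sum>i=1..N. q i) \<le> (\<Sum>i\<le>N. q i)" by (intro sum_mono2) (auto simp: q)
    also have "\<dots> = (\<Sum>i\<le>m. q i)" by (simp add: m) (simp add: q_def m Bernstein_def)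
    also have "\<dots> = 1" by (simp add: q_def m)
    finally have 2: "(\<Sum>i=1..N. q i) \<le> 1" .
    have "(\<Sum>j=1..N. r j) \<le> (\<Sum>j\<le>N. r j)" by (intro sum_mono2) (auto simp: r)
    also have "\<dots> = 1" by (simp add: r_def)
    finally have 3: "(\<Sum>j=1..N. r j) \<le> 1" .
    show ?thesis using 1 2 3 d
      by (intro mult_mono add_mono) (auto intro!: sum_nonneg mult_nonneg_nonneg add_nonneg_nonneg q r)
  qed
  finally show ?thesis by (simp add: algebra_simps)
qed

section \<open>Margins, increments and Lipschitz continuity of a copula\<close>

context
  fixes A :: "real \<Rightarrow> real \<Rightarrow> real" and \<mu> :: "(real \<times> real) measure"
  assumes dsm: "doubly_stochastic_measure_of A \<mu>"
begin

interpretation prob_space \<mu>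
  using dsm by (simp add: doubly_stochastic_measure_of_def)

lemma sets_dsm [measurable_cong]: "sets \<mu> = sets (borel \<Otimes>\<^sub>M borel)"
  using dsm unfolding doubly_stochastic_measure_of_def borel_prod by blast

lemma measure_dsm: "x \<in> {0..1} \<Longrightarrow> y \<in> {0..1} \<Longrightarrow> measure \<mu> ({0..x} \<times> {0..y}) = A x y"
  and measure_dsm_fst: "x \<in> {0..1} \<Longrightarrow> measure \<mu> ({0..x} \<times> {0..1}) = x"
  and measure_dsm_snd: "x \<in> {0..1} \<Longrightarrow> measure \<mu> ({0..1} \<times> {0..x}) = x"
  using dsm by (auto simp: doubly_stochastic_measure_of_def)

lemma dsm_increment_fst:
  assumes "0 \<le> a" "a \<le> b" "b \<le> 1" "y \<in> {0..1}"
  shows "measure \<mu> ({a<..b} \<times> {0..y}) = A b y - A a y"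
proof -
  have "{a<..b} \<times> {0..y} = {0..b} \<times> {0..y} - {0..a} \<times> {0..y}" using assms by auto
  also have "measure \<mu> \<dots> = measure \<mu> ({0..b} \<times> {0..y}) - measure \<mu> ({0..a} \<times> {0..y})"
    using assms by (intro finite_measure_Diff) auto
  finally show ?thesis using assms by (simp add: measure_dsm)
qed

lemma dsm_increment_snd:
  assumes "0 \<le> a" "a \<le> b" "b \<le> 1" "x \<in> {0..1}"
  shows "measure \<mu> ({0..x} \<times> {a<..b}) = A x b - A x a"
proof -
  have "{0..x} \<times> {a<..b} = {0..x} \<times> {0..b} - {0..x} \<times> {0..a}" using assms by auto
  also have "measure \<mu> \<dots> = measure \<mu> ({0..x} \<times> {0..b}) - measure \<mu> ({0..x} \<times> {0..a})"
    using assms by (intro finite_measure_Diff) auto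
  finally show ?thesis using assms by (simp add: measure_dsm)
qed

lemma copula_margin_snd: "x \<in> {0..1} \<Longrightarrow> A x 1 = x"
  and copula_margin_fst: "x \<in> {0..1} \<Longrightarrow> A 1 x = x"
  using measure_dsm[of x 1] measure_dsm[of 1 x] measure_dsm_fst[of x] measure_dsm_snd[of x] by auto

lemma copula_zero_fst: assumes "y \<in> {0..1}" shows "A 0 y = 0"
proof -
  have "measure \<mu> ({0..0} \<times> {0..y}) \<le> measure \<mu> ({0..0} \<times> {0..1})"
    using assms by (intro finite_measure_mono) auto
  moreover have "measure \<mu> ({0..0} \<times> {0..1}) = 0" "measure \<mu> ({0..0} \<times> {0..y}) = A 0 y"
    using assms measure_dsm_fst[of 0] measure_dsm[of 0 y] by simp_all
  ultimately show ?thesis using measure_nonneg[of \<mu> "{0..0} \<times> {0..y}"] by linarith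
qed

lemma copula_zero_snd: assumes "x \<in> {0..1}" shows "A x 0 = 0"
proof -
  have "measure \<mu> ({0..x} \<times> {0..0}) \<le> measure \<mu> ({0..1} \<times> {0..0})"
    using assms by (intro finite_measure_mono) auto
  moreover have "measure \<mu> ({0..1} \<times> {0..0}) = 0" "measure \<mu> ({0..x} \<times> {0..0}) = A x 0"
    using assms measure_dsm_snd[of 0] measure_dsm[of x 0] by simp_all
  ultimately show ?thesis using measure_nonneg[of \<mu> "{0..x} \<times> {0..0}"] by linarith
qed

text \<open>The increment is the mass of a strip of height y, which lies in the strip of full height
  and mass b - a. With b - a = 1 / N this puts each difference quotient into [0, 1].\<close>

lemma copula_increment_fst:
  assumes "0 \<le> a" "a \<le> b" "b \<le> 1" "y \<in> {0..1}"
  shows "0 \<le> A b y - A a y" "A b y - A a y \<le> b - a"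
proof -
  show "0 \<le> A b y - A a y"
    unfolding dsm_increment_fst[OF assms, symmetric] by (rule measure_nonneg)
  have "measure \<mu> ({a<..b} \<times> {0..y}) \<le> measure \<mu> ({a<..b} \<times> {0..1})"
    using assms by (intro finite_measure_mono) auto
  also have "\<dots> = A b 1 - A a 1"
    using assms by (intro dsm_increment_fst) auto
  finally show "A b y - A a y \<le> b - a"
    using assms by (simp add: dsm_increment_fst copula_margin_snd)
qed

lemma copula_increment_snd:
  assumes "0 \<le> a" "a \<le> b" "b \<le> 1" "x \<in> {0..1}"
  shows "0 \<le> A x b - A x a" "A x b - A x a \<le> b - a"
proof -
  show "0 \<le> A x b - A x a"
    unfolding dsm_increment_snd[OF assms, symmetric] by (rule measure_nonneg)
  have "measure \<mu> ({0..x} \<times> {a<..b}) \<le> measure \<mu> ({0..1} \<times> {a<..b})"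
    using assms by (intro finite_measure_mono) auto
  also have "\<dots> = A 1 b - A 1 a"
    using assms by (intro dsm_increment_snd) auto
  finally show "A x b - A x a \<le> b - a"
    using assms by (simp add: dsm_increment_snd copula_margin_fst)
qed

lemma copula_lipschitz:
  assumes "a \<in> {0..1}" "b \<in> {0..1}" "a' \<in> {0..1}" "b' \<in> {0..1}"
  shows "\<bar>A a b - A a' b'\<bar> \<le> \<bar>a - a'\<bar> + \<bar>b - b'\<bar>"
proof -
  have "\<bar>A a b - A a' b\<bar> \<le> \<bar>a - a'\<bar>"
    using copula_increment_fst[of a a' b] copula_increment_fst[of a' a b] assms
    by (cases "a \<le> a'") auto
  moreover have "\<bar>A a' b - A a' b'\<bar> \<le> \<bar>b - b'\<bar>"
    using copula_increment_snd[of b b' a'] copula_increment_snd[of b' b a'] assms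
    by (cases "b \<le> b'") auto
  ultimately show ?thesis by linarith
qed

text \<open>The increment of \<open>A\<close> is the integral of the kernel.\<close>

lemma copula_increment_kernel:
  assumes prob: "\<And>x. x \<in> {0..1} \<Longrightarrow> prob_space (K x)"
    and ker: "\<And>E1 E2. E1 \<in> sets (restrict_space borel {0..1}) \<Longrightarrow>
      E2 \<in> sets (restrict_space borel {0..1}) \<Longrightarrow>
      (\<integral>\<^sup>+x\<in>E1. emeasure (K x) E2 \<partial>lborel) = emeasure \<mu> (E1 \<times> E2)"
    and ab: "0 \<le> a" "a \<le> b" "b \<le> 1" and y: "y \<in> {0..1}"
    and K: "\<And>x. x \<in> {a..b} \<Longrightarrow> \<bar>measure (K x) {0..y} - c\<bar> \<le> e"
  shows "\<bar>(A b y - A a y) - c * (b - a)\<bar> \<le> e * (b - a)"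
proof -
  have K_eq: "emeasure (K x) {0..y} = ennreal (measure (K x) {0..y})" if "x \<in> {0..1}" for x
  proof -
    interpret K: prob_space "K x" by (rule prob) fact
    show ?thesis by (rule K.emeasure_eq_measure)
  qed
  have K_bounds: "c - e \<le> measure (K x) {0..y}" "measure (K x) {0..y} \<le> c + e" if "x \<in> {a<..b}" for x
    using K[of x] that by auto
  have A_eq: "ennreal (A b y - A a y) = (\<integral>\<^sup>+x\<in>{a<..b}. emeasure (K x) {0..y} \<partial>lborel)"
  proof (subst ker)
    show "{a<..b} \<in> sets (restrict_space borel {0..1})" "{0..y} \<in> sets (restrict_space borel {0..1})"
      using ab y by (auto simp: sets_restrict_space_iff)
    show "ennreal (A b y - A a y) = emeasure \<mu> ({a<..b} \<times> {0..y})"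
      using ab y by (simp add: emeasure_eq_measure dsm_increment_fst)
  qed
  \<comment> \<open>\<open>ennreal\<close> truncates negative numbers to 0, so the constant upper
    bound is faithful only once its sign is known.\<close>
  have ce: "0 \<le> c + e"
  proof -
    have "a \<in> {a..b}" using ab by simp
    from K[OF this] show ?thesis using measure_nonneg[of "K a" "{0..y}"] by linarith
  qed
  have "(\<integral>\<^sup>+x\<in>{a<..b}. emeasure (K x) {0..y} \<partial>lborel) \<le> (\<integral>\<^sup>+x\<in>{a<..b}. ennreal (c + e) \<partial>lborel)"
    using K_bounds ab by (intro nn_integral_mono) (auto simp: K_eq ennreal_leI split: split_indicator)
  also have "\<dots> = ennreal ((c + e) * (b - a))"
    using ab ce by (simp add: nn_integral_cmult_indicator ennreal_mult)
  finally have upper: "A b y - A a y \<le> (c + e) * (b - a)"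
    using ab ce unfolding A_eq[symmetric] by (subst (asm) ennreal_le_iff) auto
  have lower: "(c - e) * (b - a) \<le> A b y - A a y"
  \<comment> \<open>The same truncation forces a case split: a negative lower bound is settled by
    monotonicity of A rather than by the integral.\<close>
  proof (cases "0 \<le> c - e")
    case True
    have "ennreal ((c - e) * (b - a)) = (\<integral>\<^sup>+x\<in>{a<..b}. ennreal (c - e) \<partial>lborel)"
      using ab True by (simp add: nn_integral_cmult_indicator ennreal_mult)
    also have "\<dots> \<le> (\<integral>\<^sup>+x\<in>{a<..b}. emeasure (K x) {0..y} \<partial>lborel)"
      using K_bounds ab by (intro nn_integral_mono) (auto simp: K_eq ennreal_leI split: split_indicator)
    finally show ?thesis
      using copula_increment_fst(1)[OF ab y] unfolding A_eq[symmetric] by (subst (asm) ennreal_le_iff) auto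
  next
    case False
    then have "(c - e) * (b - a) \<le> 0" using ab by (intro mult_nonpos_nonneg) auto
    then show ?thesis using copula_increment_fst(1)[OF ab y] by linarith
  qed
  show ?thesis using upper lower by (simp add: abs_le_iff algebra_simps)
qed

end

section \<open>Uniform convergence of the Bernstein kernels of a copula with continuous
  kernel\<close>

lemma uniformly_continuous_on_square:
  fixes k :: "real \<Rightarrow> real \<Rightarrow> real"
  assumes "continuous_on ({0..1} \<times> {0..1}) (\<lambda>(x, y). k x y)" and "0 < \<epsilon>"
  shows "\<exists>\<delta>>0. \<forall>x\<in>{0..1}. \<forall>y\<in>{0..1}. \<forall>x'\<in>{0..1}. \<forall>y'\<in>{0..1}.
    \<bar>x - x'\<bar> < \<delta> \<longrightarrow> \<bar>y - y'\<bar> < \<delta> \<longrightarrow> \<bar>k x y - k x' y'\<bar> \<le> \<epsilon>"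
proof -
  have "uniformly_continuous_on ({0..1} \<times> {0..1}) (\<lambda>(x, y). k x y)"
    using assms(1) by (intro compact_uniformly_continuous compact_Times) auto
  then obtain d where d: "0 < d" and uc: "\<And>p q. p \<in> {0..1} \<times> {0..1} \<Longrightarrow> q \<in> {0..1} \<times> {0..1} \<Longrightarrow>
      dist q p < d \<Longrightarrow> dist (case q of (x, y) \<Rightarrow> k x y) (case p of (x, y) \<Rightarrow> k x y) < \<epsilon>"
    using assms(2) unfolding uniformly_continuous_on_def by meson
  show ?thesis
  proof (intro exI[of _ "d / 2"] conjI ballI impI)
    fix x y x' y' :: real
    assume *: "x \<in> {0..1}" "y \<in> {0..1}" "x' \<in> {0..1}" "y' \<in> {0..1}" "\<bar>x - x'\<bar> < d / 2" "\<bar>y - y'\<bar> < d / 2"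
    have "dist (x, y) (x', y') \<le> \<bar>x - x'\<bar> + \<bar>y - y'\<bar>"
      using sqrt_sum_squares_le_sum_abs[of "x - x'" "y - y'"] by (simp add: dist_Pair_Pair dist_real_def)
    then show "\<bar>k x y - k x' y'\<bar> \<le> \<epsilon>"
      using uc[of "(x', y')" "(x, y)"] * by (simp add: dist_real_def)
  qed (use d in simp)
qed

text \<open>The weights are the law of two independent binomial variables, concentrated around (m u,
  N v). Near this point uniform continuity makes the difference quotient
  \<open>\<epsilon> / 2\<close>-close to the kernel; elsewhere the error is at most 1. Instead of
  splitting the sum, the far cells are charged to a quadratic penalty \<open>t\<close>, whose mean
  is a sum of two rescaled variances.\<close>

lemma bernstein_kernel_copula_uniform:
  assumes K: "continuous_markov_kernel_of A K" and \<epsilon>: "0 < \<epsilon>"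
  shows "\<exists>N0. \<forall>N\<ge>N0. \<forall>u\<in>{0..1}. \<forall>v\<in>{0..1}.
    \<bar>bernstein_kernel N A u v - measure (K u) {0..v}\<bar> \<le> \<epsilon>"
proof -
  define k where "k x y = measure (K x) {0..y}" for x y
  obtain \<mu> where \<mu>: "doubly_stochastic_measure_of A \<mu>"
    and ker: "\<And>E1 E2. E1 \<in> sets (restrict_space borel {0..1}) \<Longrightarrow>
      E2 \<in> sets (restrict_space borel {0..1}) \<Longrightarrow>
      (\<integral>\<^sup>+x\<in>E1. emeasure (K x) E2 \<partial>lborel) = emeasure \<mu> (E1 \<times> E2)"
    and prob: "\<And>x. x \<in> {0..1} \<Longrightarrow> prob_space (K x)"
    using K unfolding continuous_markov_kernel_of_def markov_kernel_of_def by blast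
  have k01: "0 \<le> k x y" "k x y \<le> 1" if "x \<in> {0..1}" for x y
    using prob_space.prob_le_1[OF prob[OF that]] by (auto simp: k_def)
  have cont: "continuous_on ({0..1} \<times> {0..1}) (\<lambda>(x, y). k x y)"
    using K by (simp add: continuous_markov_kernel_of_def k_def)
  obtain \<delta> where \<delta>: "0 < \<delta>"
    and uc: "\<And>x y x' y'. x \<in> {0..1} \<Longrightarrow> y \<in> {0..1} \<Longrightarrow> x' \<in> {0..1} \<Longrightarrow> y' \<in> {0..1} \<Longrightarrow>
      \<bar>x - x'\<bar> < \<delta> \<Longrightarrow> \<bar>y - y'\<bar> < \<delta> \<Longrightarrow> \<bar>k x y - k x' y'\<bar> \<le> \<epsilon> / 2"
    using uniformly_continuous_on_square[OF cont, of "\<epsilon> / 2"] \<epsilon> by auto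
  \<comment> \<open>The first bound gives \<open>2 \<le> real N * \<delta>\<close>, which absorbs
    the width of a cell and the shift between m u and N u. The second makes the final variance term
    \<open>2 / (real N * \<delta>\<^sup>2)\<close> at most \<open>\<epsilon> / 2\<close>.\<close>
  define N0 where "N0 = nat \<lceil>max (2 / \<delta>) (4 / (\<epsilon> * \<delta>\<^sup>2))\<rceil>"
  show ?thesis
  proof (intro exI[of _ N0] allI impI ballI)
    fix N u v assume N: "N0 \<le> N" and u: "u \<in> {0..1::real}" and v: "v \<in> {0..1::real}"
    have N': "2 / \<delta> \<le> real N" "4 / (\<epsilon> * \<delta>\<^sup>2) \<le> real N"
      using N unfolding N0_def by linarith+
    then have N_pos: "0 < N" using \<delta> by (cases N) (auto simp: divide_le_0_iff)
    then obtain m where m: "N = Suc m" by (cases N) auto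
    have N\<delta>: "2 \<le> real N * \<delta>" using N'(1) \<delta> by (simp add: field_simps)
    define w where "w i j = Bernstein m i u * Bernstein N j v" for i j
    have w: "0 \<le> w i j" for i j using u v by (simp add: w_def Bernstein_nonneg)
    have w1: "(\<Sum>i\<le>m. \<Sum>j\<le>N. w i j) = 1"
      by (simp add: w_def flip: sum_distrib_left)
    define c where "c i j = real N * (A (real (Suc i) / real N) (real j / real N) -
      A (real i / real N) (real j / real N))" for i j
    \<comment> \<open>The Chebyshev penalty is at least 1 on far cells. The factor 4 matches the
      threshold in the first coordinate, which is half of that in the second.\<close>
    define t where "t i j = 4 * (real i - real m * u)\<^sup>2 / (real N * \<delta>)\<^sup>2 +
      (real j - real N * v)\<^sup>2 / (real N * \<delta>)\<^sup>2" for i j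
    have c: "\<bar>c i j - k u v\<bar> \<le> \<epsilon> / 2 + t i j" if ij: "i \<le> m" "j \<le> N" for i j
    proof -
      let ?a = "real i / real N" and ?b = "real (Suc i) / real N" and ?y = "real j / real N"
      have ab: "0 \<le> ?a" "?a \<le> ?b" "?b \<le> 1" and y: "?y \<in> {0..1}"
        using ij by (auto simp: m divide_simps)
      have ba: "?b - ?a = 1 / real N" by (simp add: diff_divide_distrib[symmetric])
      show ?thesis
      \<comment> \<open>For x in the cell, N x - N u differs from i - m u by at most 1, because N x
        - i and u both lie in [0, 1]. Half of \<open>real N * \<delta>\<close> leaves room for that
        1.\<close>
      proof (cases "\<bar>real i - real m * u\<bar> < real N * \<delta> / 2 \<and> \<bar>real j - real N * v\<bar> < real N * \<delta>")
        case True
        have near: "\<bar>k x ?y - k u v\<bar> \<le> \<epsilon> / 2" if x: "x \<in> {?a..?b}" for x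
        proof (rule uc)
          show "x \<in> {0..1}" using x ab by (meson atLeastAtMost_iff order_trans)
          have "real i \<le> real N * x" "real N * x \<le> real i + 1"
            using x N_pos by (auto simp: field_simps)
          moreover have "0 \<le> u" "u \<le> 1" using u by auto
          moreover have "real N * u = real m * u + u" by (simp add: m algebra_simps)
          ultimately have "\<bar>real N * x - real N * u\<bar> < real N * \<delta>"
            using True N\<delta> by linarith
          then have "real N * \<bar>x - u\<bar> < real N * \<delta>"
            by (simp add: abs_mult flip: right_diff_distrib)
          then show "\<bar>x - u\<bar> < \<delta>" using N_pos by simp
          have "real N * \<bar>?y - v\<bar> = \<bar>real j - real N * v\<bar>"
            using N_pos by (simp add: abs_mult_pos' right_diff_distrib flip: abs_mult)
          then have "real N * \<bar>?y - v\<bar> < real N * \<delta>" using True by simp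
          then show "\<bar>?y - v\<bar> < \<delta>" using N_pos by simp
        qed (use y u v in auto)
        have "\<bar>(A ?b ?y - A ?a ?y) - k u v * (?b - ?a)\<bar> \<le> \<epsilon> / 2 * (?b - ?a)"
          using near unfolding k_def by (intro copula_increment_kernel[OF \<mu> prob ker ab y]) auto
        then have "real N * \<bar>(A ?b ?y - A ?a ?y) - k u v * (1 / real N)\<bar> \<le> real N * (\<epsilon> / 2 * (1 / real N))"
          unfolding ba by (intro mult_left_mono) auto
        then have "\<bar>c i j - k u v\<bar> \<le> \<epsilon> / 2"
          using N_pos by (simp add: c_def abs_mult_pos' right_diff_distrib flip: abs_mult)
        moreover have "0 \<le> t i j" by (simp add: t_def)
        ultimately show ?thesis by linarith
      next
        case False
        \<comment> \<open>On a far cell only the trivial bound is used: the difference quotient and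
          the kernel both lie in [0, 1].\<close>
        have "0 \<le> c i j"
          unfolding c_def using copula_increment_fst(1)[OF \<mu> ab y] by (intro mult_nonneg_nonneg) auto
        moreover have "c i j \<le> real N * (?b - ?a)"
          unfolding c_def using copula_increment_fst(2)[OF \<mu> ab y] by (intro mult_left_mono) auto
        ultimately have 1: "\<bar>c i j - k u v\<bar> \<le> 1"
          using ba N_pos k01[OF u, of v] by (auto simp: abs_le_iff)
        have sq: "1 \<le> a\<^sup>2 / b\<^sup>2" if "0 < b" "b \<le> \<bar>a\<bar>" for a b :: real
          using that power_mono[of b "\<bar>a\<bar>" 2] by simp
        have "1 \<le> t i j"
        proof (cases "real N * \<delta> \<le> \<bar>real j - real N * v\<bar>")
          case True
          then have "1 \<le> (real j - real N * v)\<^sup>2 / (real N * \<delta>)\<^sup>2" using N\<delta> by (intro sq) auto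
          then show ?thesis by (simp add: t_def add_increasing)
        next
          case 2: False
          have "1 \<le> (2 * (real i - real m * u))\<^sup>2 / (real N * \<delta>)\<^sup>2"
          proof (rule sq)
            show "0 < real N * \<delta>" using N\<delta> by linarith
            have "real N * \<delta> / 2 \<le> \<bar>real i - real m * u\<bar>" using 2 False by linarith
            then show "real N * \<delta> \<le> \<bar>2 * (real i - real m * u)\<bar>" unfolding abs_mult by simp
          qed
          then have "1 \<le> 4 * (real i - real m * u)\<^sup>2 / (real N * \<delta>)\<^sup>2"
            by (simp only: power_mult_distrib[of 2]) simp
          then show ?thesis by (simp add: t_def add_increasing2)
        qed
        then show ?thesis using 1 \<epsilon> by linarith
      qed
    qed
    have "bernstein_kernel N A u v = (\<Sum>i\<le>m. \<Sum>j\<le>N. c i j * w i j)"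
      unfolding m c_def w_def
    proof (rule bernstein_kernel_by_parts)
      show "A 0 (real j / real (Suc m)) = 0" "A (real j / real (Suc m)) 0 = 0" if "j \<le> Suc m" for j
        using that by (auto intro!: copula_zero_fst[OF \<mu>] copula_zero_snd[OF \<mu>])
    qed
    then have "bernstein_kernel N A u v - k u v = (\<Sum>i\<le>m. \<Sum>j\<le>N. (c i j - k u v) * w i j)"
      using w1 by (simp add: left_diff_distrib sum_subtractf flip: sum_distrib_left)
    also have "\<bar>\<dots>\<bar> \<le> (\<Sum>i\<le>m. \<Sum>j\<le>N. (\<epsilon> / 2 + t i j) * w i j)"
      by (intro order.trans[OF sum_abs] sum_mono) (auto simp: abs_mult w intro!: mult_right_mono c)
    also have "\<dots> = \<epsilon> / 2 + (\<Sum>i\<le>m. \<Sum>j\<le>N. t i j * w i j)"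
      by (simp only: distrib_right sum.distrib sum_distrib_left[symmetric] w1 mult_1_right)
    \<comment> \<open>Each of the two terms of \<open>t\<close> depends on one index only, so the
      double sum factors and the other family of weights sums to 1.\<close>
    also have "(\<Sum>i\<le>m. \<Sum>j\<le>N. t i j * w i j) =
        4 / (real N * \<delta>)\<^sup>2 * (\<Sum>i\<le>m. (real i - real m * u)\<^sup>2 * Bernstein m i u) * (\<Sum>j\<le>N. Bernstein N j v) +
        1 / (real N * \<delta>)\<^sup>2 * (\<Sum>j\<le>N. (real j - real N * v)\<^sup>2 * Bernstein N j v) * (\<Sum>i\<le>m. Bernstein m i u)"
    proof -
      have "t i j * w i j = (4 / (real N * \<delta>)\<^sup>2 * ((real i - real m * u)\<^sup>2 * Bernstein m i u)) * Bernstein N j v +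
          Bernstein m i u * (1 / (real N * \<delta>)\<^sup>2 * ((real j - real N * v)\<^sup>2 * Bernstein N j v))" for i j
        by (simp add: t_def w_def algebra_simps)
      then have "(\<Sum>i\<le>m. \<Sum>j\<le>N. t i j * w i j) =
          (\<Sum>i\<le>m. 4 / (real N * \<delta>)\<^sup>2 * ((real i - real m * u)\<^sup>2 * Bernstein m i u)) * (\<Sum>j\<le>N. Bernstein N j v) +
          (\<Sum>i\<le>m. Bernstein m i u) * (\<Sum>j\<le>N. 1 / (real N * \<delta>)\<^sup>2 * ((real j - real N * v)\<^sup>2 * Bernstein N j v))"
        by (simp only: sum.distrib sum_product)
      then show ?thesis
        by (simp only: sum_distrib_left[symmetric] mult.commute[of "\<Sum>i\<le>m. Bernstein m i u"])
    qed
    also have "\<dots> \<le> 4 / (real N * \<delta>)\<^sup>2 * (real m / 4) * 1 + 1 / (real N * \<delta>)\<^sup>2 * (real N / 4) * 1"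
      using u v by (intro add_mono mult_mono sum_Bernstein_variance_le)
        (auto intro!: mult_nonneg_nonneg sum_nonneg Bernstein_nonneg)
    also have "\<dots> = (real m + real N / 4) / (real N * \<delta>)\<^sup>2"
      by (simp add: add_divide_distrib)
    also have "\<dots> \<le> 2 * real N / (real N * \<delta>)\<^sup>2"
      by (intro divide_right_mono) (auto simp: m)
    also have "\<dots> = 2 / (real N * \<delta>\<^sup>2)"
      using N_pos by (simp add: power2_eq_square)
    also have "\<dots> \<le> \<epsilon> / 2"
      using N'(2) \<epsilon> \<delta> N_pos by (simp add: field_simps)
    finally show "\<bar>bernstein_kernel N A u v - measure (K u) {0..v}\<bar> \<le> \<epsilon>"
      by (simp add: k_def)
  qed
qed

section \<open>The empirical copula\<close>

lemma exists_card_le_threshold: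
  fixes T :: "real set"
  assumes "finite T" "i \<le> card T"
  shows "\<exists>x. card {t\<in>T. t \<le> x} = i"
  using assms
proof (induction T arbitrary: i rule: finite_linorder_max_induct)
  case empty
  then show ?case by simp
next
  case (insert b T)
  have b: "b \<notin> T" using insert by auto
  show ?case
  proof (cases "i = card (insert b T)")
    case True
    have "{t \<in> insert b T. t \<le> b} = insert b T" using insert by force
    then show ?thesis using True by metis
  next
    case False
    then obtain x where x: "card {t \<in> T. t \<le> x} = i"
      using insert b by (metis card_insert_disjoint le_Suc_eq)
    \<comment> \<open>The threshold has to stay below the new maximum b without losing an element of
      T, so it is capped at the maximum of T; b - 1 serves when T is empty.\<close>
    define x' where "x' = min x (Max (insert (b - 1) T))"
    have "x' < b" using insert by (auto simp: x'_def min_less_iff_disj)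
    moreover have "t \<le> x' \<longleftrightarrow> t \<le> x" if "t \<in> T" for t
      using that insert by (auto simp: x'_def)
    ultimately have "{t \<in> insert b T. t \<le> x'} = {t \<in> T. t \<le> x}" by auto
    then show ?thesis using x by metis
  qed
qed

text \<open>Without ties every count from 0 to n is attained. This yields the uniqueness of the
  empirical subcopula: the equation for H_n then reaches every grid point.\<close>

lemma exists_count_eq:
  fixes f :: "nat \<Rightarrow> real"
  assumes "inj_on f {..<n}" "i \<le> n"
  shows "\<exists>x. card {k\<in>{..<n}. f k \<le> x} = i"
proof -
  obtain x where x: "card {t \<in> f ` {..<n}. t \<le> x} = i"
    using exists_card_le_threshold[of "f ` {..<n}" i] assms by (auto simp: card_image)
  have "{t \<in> f ` {..<n}. t \<le> x} = f ` {k\<in>{..<n}. f k \<le> x}" by auto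
  moreover have "inj_on f {k\<in>{..<n}. f k \<le> x}"
    using assms(1) by (rule inj_on_subset) auto
  ultimately have "card {k\<in>{..<n}. f k \<le> x} = i" using x card_image by fastforce
  then show ?thesis ..
qed

section \<open>Ranks and the explicit empirical subcopula\<close>

lemma count_le: "card {k\<in>{..<n}. P k} \<le> n" for n :: nat
  using card_mono[of "{..<n}" "{k\<in>{..<n}. P k}"] by auto

definition sample_rank :: "nat \<Rightarrow> (nat \<Rightarrow> real) \<Rightarrow> nat \<Rightarrow> nat" where
  "sample_rank n f k = card {l\<in>{..<n}. f l \<le> f k}"

text \<open>The sublevel sets are nested, and if x lies below \<open>f k\<close>, then k itself is
  counted in the rank but not at x. Thresholds on the line thus become grid indices.\<close>

lemma rank_le_count_iff:
  assumes "k < n"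
  shows "sample_rank n f k \<le> card {l\<in>{..<n}. f l \<le> x} \<longleftrightarrow> f k \<le> x"
proof
  assume "f k \<le> x"
  then show "sample_rank n f k \<le> card {l\<in>{..<n}. f l \<le> x}"
    unfolding sample_rank_def by (intro card_mono) auto
next
  assume le: "sample_rank n f k \<le> card {l\<in>{..<n}. f l \<le> x}"
  show "f k \<le> x"
  proof (rule ccontr)
    assume "\<not> f k \<le> x"
    then have "{l\<in>{..<n}. f l \<le> x} \<subset> {l\<in>{..<n}. f l \<le> f k}"
      using assms by force
    then have "card {l\<in>{..<n}. f l \<le> x} < sample_rank n f k"
      unfolding sample_rank_def by (intro psubset_card_mono) auto
    then show False using le by simp
  qed
qed

lemma card_rank_le:
  assumes "inj_on f {..<n}" "i \<le> n"
  shows "card {k\<in>{..<n}. sample_rank n f k \<le> i} = i"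
proof -
  obtain x where x: "card {k\<in>{..<n}. f k \<le> x} = i" using exists_count_eq[OF assms] by blast
  have "{k\<in>{..<n}. sample_rank n f k \<le> i} = {k\<in>{..<n}. f k \<le> x}"
    using rank_le_count_iff[of _ n f x, unfolded x] by auto
  then show ?thesis using x by simp
qed

lemma rank_pos: "k < n \<Longrightarrow> sample_rank n f k \<noteq> 0"
  by (auto simp: sample_rank_def card_gt_0_iff)

lemma rank_le: "sample_rank n f k \<le> n"
  unfolding sample_rank_def by (rule count_le)

text \<open>This is the joint empirical distribution function of the ranks. The value 0 off the grid
  follows the convention of \<open>grid_subcopula\<close>, which makes equality of functions
  attainable in the uniqueness proof.\<close>

definition rank_subcopula :: "nat \<Rightarrow> (nat \<Rightarrow> real) \<Rightarrow> (nat \<Rightarrow> real) \<Rightarrow> nat \<Rightarrow> nat \<Rightarrow> real" where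
  "rank_subcopula n f g i j =
    (if i \<le> n \<and> j \<le> n then real (card {k\<in>{..<n}. sample_rank n f k \<le> i \<and> sample_rank n g k \<le> j}) / real n else 0)"

lemma grid_subcopula_rank_subcopula:
  assumes f: "inj_on f {..<n}" and g: "inj_on g {..<n}"
  shows "grid_subcopula n (rank_subcopula n f g)"
  unfolding grid_subcopula_def
proof (intro conjI allI impI)
  fix i assume i: "i \<le> n"
  have "{k\<in>{..<n}. sample_rank n f k \<le> i \<and> sample_rank n g k \<le> 0} = {}"
    using rank_pos[of _ n g] by auto
  then show "rank_subcopula n f g i 0 = 0"
    unfolding rank_subcopula_def by (simp only: card.empty) simp
  have "{k\<in>{..<n}. sample_rank n f k \<le> 0 \<and> sample_rank n g k \<le> i} = {}"
    using rank_pos[of _ n f] by auto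
  then show "rank_subcopula n f g 0 i = 0"
    unfolding rank_subcopula_def by (simp only: card.empty) simp
  show "rank_subcopula n f g i n = real i / real n" "rank_subcopula n f g n i = real i / real n"
    using i card_rank_le[OF f i] card_rank_le[OF g i] by (auto simp: rank_subcopula_def rank_le)
next
  fix i1 i2 j1 j2 assume *: "i1 \<le> i2 \<and> i2 \<le> n \<and> j1 \<le> j2 \<and> j2 \<le> n"
  define S where "S i j = {k\<in>{..<n}. sample_rank n f k \<le> i \<and> sample_rank n g k \<le> j}" for i j
  have fin: "finite (S i j)" for i j by (simp add: S_def)
  \<comment> \<open>The rectangle inequality is inclusion-exclusion for these two sets, whose union
    lies in \<open>S i2 j2\<close>.\<close>
  have "S i1 j2 \<inter> S i2 j1 = S i1 j1" using * by (auto simp: S_def)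
  then have "card (S i1 j2) + card (S i2 j1) = card (S i1 j2 \<union> S i2 j1) + card (S i1 j1)"
    using card_Un_Int[OF fin fin, of i1 j2 i2 j1] by simp
  also have "card (S i1 j2 \<union> S i2 j1) \<le> card (S i2 j2)"
    using * by (intro card_mono fin) (auto simp: S_def)
  finally have "real (card (S i1 j2)) + real (card (S i2 j1)) \<le> real (card (S i2 j2)) + real (card (S i1 j1))"
    by linarith
  then have "0 \<le> (real (card (S i2 j2)) - real (card (S i1 j2)) - real (card (S i2 j1)) + real (card (S i1 j1))) / real n"
    by (intro divide_nonneg_nonneg) auto
  then show "0 \<le> rank_subcopula n f g i2 j2 - rank_subcopula n f g i1 j2 - rank_subcopula n f g i2 j1 +
      rank_subcopula n f g i1 j1"
    using * by (simp add: rank_subcopula_def S_def diff_divide_distrib add_divide_distrib)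
qed (auto simp: rank_subcopula_def)

lemma emp_joint_eq_rank_subcopula:
  "emp_joint X Y n \<omega> x y = rank_subcopula n (\<lambda>k. X k \<omega>) (\<lambda>k. Y k \<omega>)
    (card {k\<in>{..<n}. X k \<omega> \<le> x}) (card {k\<in>{..<n}. Y k \<omega> \<le> y})"
proof -
  have "{k\<in>{..<n}. sample_rank n (\<lambda>k. X k \<omega>) k \<le> card {k\<in>{..<n}. X k \<omega> \<le> x} \<and>
      sample_rank n (\<lambda>k. Y k \<omega>) k \<le> card {k\<in>{..<n}. Y k \<omega> \<le> y}} =
    {k\<in>{..<n}. X k \<omega> \<le> x \<and> Y k \<omega> \<le> y}"
    using rank_le_count_iff[of _ n "\<lambda>k. X k \<omega>" x] rank_le_count_iff[of _ n "\<lambda>k. Y k \<omega>" y] by auto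
  then show ?thesis unfolding emp_joint_def rank_subcopula_def by (simp only: count_le if_True simp_thms)
qed

text \<open>Existence is the rank construction. For uniqueness, each grid point is written as a pair
  of counts, where H_n prescribes the value; off the grid both candidates are 0.\<close>

lemma emp_subcopula_eq_rank_subcopula:
  assumes X: "inj_on (\<lambda>k. X k \<omega>) {..<n}" and Y: "inj_on (\<lambda>k. Y k \<omega>) {..<n}"
  shows "emp_subcopula X Y n \<omega> = rank_subcopula n (\<lambda>k. X k \<omega>) (\<lambda>k. Y k \<omega>)"
  unfolding emp_subcopula_def
proof (rule the_equality)
  let ?R = "rank_subcopula n (\<lambda>k. X k \<omega>) (\<lambda>k. Y k \<omega>)"
  show R: "grid_subcopula n ?R \<and> (\<forall>x y. emp_joint X Y n \<omega> x y =
      ?R (card {k\<in>{..<n}. X k \<omega> \<le> x}) (card {k\<in>{..<n}. Y k \<omega> \<le> y}))"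
    by (intro conjI allI grid_subcopula_rank_subcopula[OF X Y]) (rule emp_joint_eq_rank_subcopula)
  fix E assume E: "grid_subcopula n E \<and> (\<forall>x y. emp_joint X Y n \<omega> x y =
      E (card {k\<in>{..<n}. X k \<omega> \<le> x}) (card {k\<in>{..<n}. Y k \<omega> \<le> y}))"
  show "E = ?R"
  proof (intro ext)
    fix i j
    show "E i j = ?R i j"
    proof (cases "i \<le> n \<and> j \<le> n")
      case True
      obtain x y where x: "card {k\<in>{..<n}. X k \<omega> \<le> x} = i" and y: "card {k\<in>{..<n}. Y k \<omega> \<le> y} = j"
        using exists_count_eq[OF X, of i] exists_count_eq[OF Y, of j] True by blast
      show ?thesis using E R unfolding x[symmetric] y[symmetric] by metis
    next
      case False
      then show ?thesis using E R by (metis grid_subcopula_def not_le)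
    qed
  qed
qed

text \<open>Bilinear interpolation is a convex combination of the four corner values. Each corner is
  within 1 / n of (u, v) in both coordinates, so the Lipschitz bound costs 2 / n.\<close>

lemma bilinear_ext_diff_le:
  assumes n: "0 < n" and u: "u \<in> {0..1}" and v: "v \<in> {0..1}"
    and lip: "\<And>a b a' b'. a \<in> {0..1} \<Longrightarrow> b \<in> {0..1} \<Longrightarrow> a' \<in> {0..1} \<Longrightarrow> b' \<in> {0..1} \<Longrightarrow>
      \<bar>A a b - A a' b'\<bar> \<le> \<bar>a - a'\<bar> + \<bar>b - b'\<bar>"
    and E: "\<And>i j. i \<le> n \<Longrightarrow> j \<le> n \<Longrightarrow> \<bar>E i j - A (real i / real n) (real j / real n)\<bar> \<le> d"
  shows "\<bar>bilinear_ext n E u v - A u v\<bar> \<le> d + 2 / real n"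
proof -
  \<comment> \<open>The minimum with n - 1 assigns t = 1 to the last cell, so that i + 1 remains a
    grid index; the upper inequality is therefore not strict.\<close>
  have cell: "\<exists>i. nat (min (int n - 1) \<lfloor>real n * t\<rfloor>) = i \<and> Suc i \<le> n \<and> real i \<le> real n * t \<and> real n * t \<le> real i + 1"
    if "t \<in> {0..1}" for t
  proof -
    have *: "0 \<le> real n * t" "real n * t \<le> real n" using that by (auto simp: mult_left_le)
    show ?thesis using n *
      by (intro exI[of _ "nat (min (int n - 1) \<lfloor>real n * t\<rfloor>)"]) (auto simp: min_def; linarith)
  qed
  obtain i where i: "nat (min (int n - 1) \<lfloor>real n * u\<rfloor>) = i" "Suc i \<le> n" "real i \<le> real n * u" "real n * u \<le> real i + 1"
    using cell[OF u] by blast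
  obtain j where j: "nat (min (int n - 1) \<lfloor>real n * v\<rfloor>) = j" "Suc j \<le> n" "real j \<le> real n * v" "real n * v \<le> real j + 1"
    using cell[OF v] by blast
  define a where "a = real n * u - real i"
  define b where "b = real n * v - real j"
  have a: "0 \<le> a" "0 \<le> 1 - a" and b: "0 \<le> b" "0 \<le> 1 - b" using i j by (auto simp: a_def b_def)
  have near: "\<bar>E i' j' - A u v\<bar> \<le> d + 2 / real n" if "i' \<in> {i, i + 1}" "j' \<in> {j, j + 1}" for i' j'
  proof -
    have 1: "\<bar>real i' / real n - u\<bar> \<le> 1 / real n" "\<bar>real j' / real n - v\<bar> \<le> 1 / real n"
    proof -
      have "\<bar>real i' - real n * u\<bar> \<le> 1" "\<bar>real j' - real n * v\<bar> \<le> 1" using that i(3,4) j(3,4) by auto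
      moreover have "\<bar>real a / real n - t\<bar> = \<bar>real a - real n * t\<bar> / real n" for a t
      proof -
        have "real a / real n - t = (real a - real n * t) / real n" using n by (simp add: field_simps)
        then show ?thesis by (simp add: abs_divide)
      qed
      ultimately show "\<bar>real i' / real n - u\<bar> \<le> 1 / real n" "\<bar>real j' / real n - v\<bar> \<le> 1 / real n"
        by (simp_all add: divide_right_mono)
    qed
    have "\<bar>A (real i' / real n) (real j' / real n) - A u v\<bar> \<le> \<bar>real i' / real n - u\<bar> + \<bar>real j' / real n - v\<bar>"
      using that i(2) j(2) n u v by (intro lip) (auto simp: divide_simps)
    moreover have "\<bar>E i' j' - A (real i' / real n) (real j' / real n)\<bar> \<le> d"
      using that i(2) j(2) by (intro E) auto
    ultimately show ?thesis using 1 by (simp add: add_divide_distrib[symmetric])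
  qed
  define e where "e i' j' = E i' j' - A u v" for i' j'
  have "bilinear_ext n E u v - A u v =
      (1 - a) * (1 - b) * e i j + a * (1 - b) * e (i + 1) j + (1 - a) * b * e i (j + 1) + a * b * e (i + 1) (j + 1)"
    unfolding bilinear_ext_def Let_def i j a_def[symmetric] b_def[symmetric] e_def by (simp add: algebra_simps)
  also have "\<bar>\<dots>\<bar> \<le> \<bar>(1 - a) * (1 - b) * e i j\<bar> + \<bar>a * (1 - b) * e (i + 1) j\<bar> +
      \<bar>(1 - a) * b * e i (j + 1)\<bar> + \<bar>a * b * e (i + 1) (j + 1)\<bar>"
    by linarith
  also have "\<dots> = (1 - a) * (1 - b) * \<bar>e i j\<bar> + a * (1 - b) * \<bar>e (i + 1) j\<bar> +
      (1 - a) * b * \<bar>e i (j + 1)\<bar> + a * b * \<bar>e (i + 1) (j + 1)\<bar>"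
    using a b by (simp add: abs_mult)
  also have "\<dots> \<le> (1 - a) * (1 - b) * (d + 2 / real n) + a * (1 - b) * (d + 2 / real n) +
      (1 - a) * b * (d + 2 / real n) + a * b * (d + 2 / real n)"
    unfolding e_def using a b by (intro add_mono mult_left_mono near mult_nonneg_nonneg) auto
  also have "\<dots> = d + 2 / real n" by algebra
  finally show ?thesis .
qed

text \<open>At a grid point choose x and y with F_n x = i / n and G_n y = j / n. One d pays for
  replacing H_n by H, two more for replacing F x and G y by these grid values; 2 / n is the
  interpolation error.\<close>

lemma emp_copula_diff_le:
  assumes n: "0 < n" and X: "inj_on (\<lambda>k. X k \<omega>) {..<n}" and Y: "inj_on (\<lambda>k. Y k \<omega>) {..<n}"
    and u: "u \<in> {0..1}" and v: "v \<in> {0..1}"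
    and lip: "\<And>a b a' b'. a \<in> {0..1} \<Longrightarrow> b \<in> {0..1} \<Longrightarrow> a' \<in> {0..1} \<Longrightarrow> b' \<in> {0..1} \<Longrightarrow>
      \<bar>A a b - A a' b'\<bar> \<le> \<bar>a - a'\<bar> + \<bar>b - b'\<bar>"
    and F: "\<And>x. F x \<in> {0..1}" "\<And>x. \<bar>emp_cdf X n \<omega> x - F x\<bar> \<le> d"
    and G: "\<And>y. G y \<in> {0..1}" "\<And>y. \<bar>emp_cdf Y n \<omega> y - G y\<bar> \<le> d"
    and H: "\<And>x y. \<bar>emp_joint X Y n \<omega> x y - A (F x) (G y)\<bar> \<le> d"
  shows "\<bar>emp_copula X Y n \<omega> u v - A u v\<bar> \<le> 3 * d + 2 / real n"
  unfolding emp_copula_def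
proof (rule bilinear_ext_diff_le[OF n u v lip])
  fix i j assume ij: "i \<le> n" "j \<le> n"
  obtain x y where x: "card {k\<in>{..<n}. X k \<omega> \<le> x} = i" and y: "card {k\<in>{..<n}. Y k \<omega> \<le> y} = j"
    using exists_count_eq[OF X, of i] exists_count_eq[OF Y, of j] ij by blast
  have x': "emp_cdf X n \<omega> x = real i / real n" and y': "emp_cdf Y n \<omega> y = real j / real n"
    by (simp_all only: emp_cdf_def x y)
  have "emp_subcopula X Y n \<omega> i j = emp_joint X Y n \<omega> x y"
    by (simp only: emp_subcopula_eq_rank_subcopula[of X \<omega> n Y, OF X Y] emp_joint_eq_rank_subcopula x y)
  moreover have "\<bar>A (F x) (G y) - A (real i / real n) (real j / real n)\<bar> \<le>
      \<bar>F x - real i / real n\<bar> + \<bar>G y - real j / real n\<bar>"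
    using ij n by (intro lip F G) (auto simp: divide_simps)
  ultimately show "\<bar>emp_subcopula X Y n \<omega> i j - A (real i / real n) (real j / real n)\<bar> \<le> 3 * d"
    using F(2)[of x] G(2)[of y] H[of x y] x' y' by linarith
qed

section \<open>Uniform rate for empirical distribution functions\<close>

text \<open>Continuity is given for the joint function only, so the atom is first cut by Y \<le> y.
  That slice is bounded by an increment of H in x, which tends to 0; letting y run through the
  naturals exhausts the atom.\<close>

lemma (in prob_space) continuous_joint_cdf_no_atom:
  assumes [measurable]: "random_variable borel X" "random_variable borel Y"
    and H: "\<And>x y. H x y = prob {\<omega>\<in>space M. X \<omega> \<le> x \<and> Y \<omega> \<le> y}"
    and cont: "continuous_on UNIV (\<lambda>(x::real, y::real). H x y)"
  shows "prob {\<omega>\<in>space M. X \<omega> = x} = 0"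
proof -
  have slice: "prob {\<omega>\<in>space M. X \<omega> = x \<and> Y \<omega> \<le> y} = 0" for y
  proof -
    have "continuous_on UNIV ((\<lambda>(x, y). H x y) \<circ> (\<lambda>t. (t, y)))"
      by (intro continuous_on_compose continuous_on_subset[OF cont] continuous_intros) auto
    then have "isCont (\<lambda>t. H t y) x" by (simp add: o_def continuous_on_eq_continuous_at)
    moreover have "(\<lambda>n. x - 1 / real (Suc n)) \<longlonglongrightarrow> x - 0"
      by (intro tendsto_diff tendsto_const LIMSEQ_inverse_real_of_nat[unfolded inverse_eq_divide])
    ultimately have "(\<lambda>n. H (x - 1 / real (Suc n)) y) \<longlonglongrightarrow> H x y"
      by (intro isCont_tendsto_compose[of x "\<lambda>t. H t y"]) auto
    then have "(\<lambda>n. H x y - H (x - 1 / real (Suc n)) y) \<longlonglongrightarrow> H x y - H x y"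
      by (intro tendsto_diff tendsto_const)
    moreover have "prob {\<omega>\<in>space M. X \<omega> = x \<and> Y \<omega> \<le> y} \<le> H x y - H (x - 1 / real (Suc n)) y" for n
    proof -
      have "prob {\<omega>\<in>space M. X \<omega> = x \<and> Y \<omega> \<le> y} + H (x - 1 / real (Suc n)) y =
          prob ({\<omega>\<in>space M. X \<omega> = x \<and> Y \<omega> \<le> y} \<union>
            {\<omega>\<in>space M. X \<omega> \<le> x - 1 / real (Suc n) \<and> Y \<omega> \<le> y})"
        unfolding H by (intro finite_measure_Union[symmetric]) (auto simp: field_simps)
      also have "\<dots> \<le> H x y"
        unfolding H by (intro finite_measure_mono) (auto intro: order_trans)
      finally show ?thesis by simp
    qed
    ultimately have "prob {\<omega>\<in>space M. X \<omega> = x \<and> Y \<omega> \<le> y} \<le> 0"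
      by (intro LIMSEQ_le_const[where X="\<lambda>n. H x y - H (x - 1 / real (Suc n)) y"]) auto
    then show ?thesis by (simp add: measure_le_0_iff)
  qed
  have "{\<omega>\<in>space M. X \<omega> = x} = (\<Union>n. {\<omega>\<in>space M. X \<omega> = x \<and> Y \<omega> \<le> real n})"
    using real_arch_simple by auto
  moreover have "(\<Union>n. {\<omega>\<in>space M. X \<omega> = x \<and> Y \<omega> \<le> real n}) \<in> null_sets M"
    using slice by (intro null_sets_UN null_setsI) (auto simp: emeasure_eq_measure)
  ultimately show ?thesis by (simp add: measure_eq_0_null_sets)
qed

text \<open>By independence the joint law of the two variables is a product, and every section of
  the diagonal is a single point of mass 0.\<close>

lemma (in prob_space) indep_vars_AE_neq:
  fixes X :: "nat \<Rightarrow> 'a \<Rightarrow> real"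
  assumes indep: "indep_vars (\<lambda>_. borel) X UNIV"
    and atom: "\<And>k x. prob {\<omega>\<in>space M. X k \<omega> = x} = 0"
    and kl: "k \<noteq> l"
  shows "AE \<omega> in M. X k \<omega> \<noteq> X l \<omega>"
proof -
  have rv [measurable]: "random_variable borel (X i)" for i
    using indep by (auto simp: indep_vars_def)
  have "indep_var (PiM {k} (\<lambda>_. borel)) (\<lambda>\<omega>. restrict (\<lambda>i. X i \<omega>) {k})
      (PiM {l} (\<lambda>_. borel)) (\<lambda>\<omega>. restrict (\<lambda>i. X i \<omega>) {l})"
    using indep kl by (intro indep_var_restrict) auto
  then have "indep_var borel ((\<lambda>f. f k) \<circ> (\<lambda>\<omega>. restrict (\<lambda>i. X i \<omega>) {k}))
      borel ((\<lambda>f. f l) \<circ> (\<lambda>\<omega>. restrict (\<lambda>i. X i \<omega>) {l}))"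
    by (rule indep_var_compose) auto
  then have "indep_var borel (X k) borel (X l)" by (simp add: o_def)
  then have joint: "distr M borel (X k) \<Otimes>\<^sub>M distr M borel (X l) =
      distr M (borel \<Otimes>\<^sub>M borel) (\<lambda>\<omega>. (X k \<omega>, X l \<omega>))"
    by (simp add: indep_var_distribution_eq)
  let ?D = "{p. fst p = snd p} :: (real \<times> real) set"
  interpret l: prob_space "distr M borel (X l)" by (rule prob_space_distr) simp
  have D: "?D \<in> sets (borel \<Otimes>\<^sub>M borel)"
    unfolding borel_prod by (intro borel_closed closed_Collect_eq continuous_intros)
  have "emeasure (distr M borel (X k) \<Otimes>\<^sub>M distr M borel (X l)) ?D =
      (\<integral>\<^sup>+x. emeasure (distr M borel (X l)) (Pair x -` ?D) \<partial>distr M borel (X k))"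
    using D by (intro l.emeasure_pair_measure_alt) (simp cong: sets_pair_measure_cong)
  also have "\<dots> = (\<integral>\<^sup>+x. 0 \<partial>distr M borel (X k))"
  proof (intro nn_integral_cong)
    fix x
    have "Pair x -` ?D = {x}" by auto
    moreover have "X l -` {x} \<inter> space M = {\<omega>\<in>space M. X l \<omega> = x}" by auto
    ultimately show "emeasure (distr M borel (X l)) (Pair x -` ?D) = 0"
      using atom[of l x] by (simp add: emeasure_distr emeasure_eq_measure)
  qed
  finally have "emeasure M ((\<lambda>\<omega>. (X k \<omega>, X l \<omega>)) -` ?D \<inter> space M) = 0"
    unfolding joint using D by (subst (asm) emeasure_distr) auto
  then have "emeasure M {\<omega>\<in>space M. \<not> X k \<omega> \<noteq> X l \<omega>} = 0"
    by (simp add: vimage_def Int_def conj_commute)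
  then show ?thesis by (subst AE_iff_measurable[OF _ refl]) auto
qed

lemma (in prob_space) AE_inj_sample:
  fixes X :: "nat \<Rightarrow> 'a \<Rightarrow> real"
  assumes indep: "indep_vars (\<lambda>_. borel) X UNIV"
    and atom: "\<And>k x. prob {\<omega>\<in>space M. X k \<omega> = x} = 0"
  shows "AE \<omega> in M. inj (\<lambda>k. X k \<omega>)"
proof -
  have "AE \<omega> in M. \<forall>k l. k \<noteq> l \<longrightarrow> X k \<omega> \<noteq> X l \<omega>"
    using indep_vars_AE_neq[OF indep atom] by (simp add: AE_all_countable)
  then show ?thesis by eventually_elim (auto simp: inj_def)
qed

section \<open>Concentration for one set, then bracketing for all quadrants\<close>

lemma (in prob_space) empirical_measure_Hoeffding:
  assumes indep: "indep_vars (\<lambda>_. N) Z UNIV"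
    and dist: "\<And>k. distr M N (Z k) = D" and S [measurable]: "S \<in> sets N"
    and n: "0 < n" and \<epsilon>: "0 \<le> \<epsilon>"
  shows "prob {\<omega>\<in>space M. \<epsilon> \<le> \<bar>real (card {k\<in>{..<n}. Z k \<omega> \<in> S}) / real n - measure D S\<bar>}
    \<le> 2 * exp (- 2 * real n * \<epsilon>\<^sup>2)"
proof -
  have rv [measurable]: "random_variable N (Z k)" for k
    using indep by (auto simp: indep_vars_def)
  let ?I = "\<lambda>k \<omega>. indicator S (Z k \<omega>) :: real"
  have mean: "expectation (?I k) = measure D S" for k
  proof -
    have "expectation (?I k) = expectation (indicator (Z k -` S \<inter> space M))"
      by (intro Bochner_Integration.integral_cong) (auto split: split_indicator)
    also have "\<dots> = measure D S"
      unfolding dist[of k, symmetric] by (simp add: measure_distr)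
    finally show ?thesis .
  qed
  \<comment> \<open>The indicators have range [0, 1], so the squared ranges sum to n. A deviation
    \<open>real n * \<epsilon>\<close> of the sum then yields the exponent
    \<open>- 2 * real n * \<epsilon>\<^sup>2\<close>.\<close>
  interpret Hoeffding_ineq M "{..<n}" ?I "\<lambda>_. 0" "\<lambda>_. 1" "real n * measure D S"
  proof unfold_locales
    show "indep_vars (\<lambda>_. borel) ?I {..<n}"
      by (rule indep_vars_subset[OF indep_vars_compose2[OF indep]]) auto
  qed (auto simp: mean split: split_indicator)
  have sum: "(\<Sum>k<n. ?I k \<omega>) = real (card {k\<in>{..<n}. Z k \<omega> \<in> S})" for \<omega>
    using sum.inter_filter[of "{..<n}" "\<lambda>_. 1::real" "\<lambda>k. Z k \<omega> \<in> S"]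
    by (simp add: indicator_def of_bool_def)
  have "real n * \<epsilon> \<le> \<bar>(\<Sum>k<n. ?I k \<omega>) - real n * measure D S\<bar> \<longleftrightarrow>
      \<epsilon> \<le> \<bar>real (card {k\<in>{..<n}. Z k \<omega> \<in> S}) / real n - measure D S\<bar>" for \<omega>
  proof -
    have "\<bar>(\<Sum>k<n. ?I k \<omega>) - real n * measure D S\<bar> =
        \<bar>real n * (real (card {k\<in>{..<n}. Z k \<omega> \<in> S}) / real n - measure D S)\<bar>"
      using n unfolding sum by (simp add: right_diff_distrib)
    then show ?thesis using n by (simp add: abs_mult)
  qed
  then have "prob {\<omega>\<in>space M. \<epsilon> \<le> \<bar>real (card {k\<in>{..<n}. Z k \<omega> \<in> S}) / real n - measure D S\<bar>} \<le>
      2 * exp (- 2 * (real n * \<epsilon>)\<^sup>2 / real n)"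
    using Hoeffding_ineq_abs_ge[of "real n * \<epsilon>"] n \<epsilon> by simp
  also have "- 2 * (real n * \<epsilon>)\<^sup>2 / real n = - 2 * real n * \<epsilon>\<^sup>2"
    using n by (simp add: power2_eq_square)
  finally show ?thesis .
qed

text \<open>The whole line plays the role of the endpoint infinity: one estimate over products of
  such sets covers H_n and both marginal empirical distribution functions.\<close>

definition down_sets :: "real set set" where
  "down_sets = insert UNIV (range atMost)"

text \<open>Without atoms the distribution function is continuous, so the intermediate value theorem
  supplies a quantile for every level strictly between 0 and 1. The empty set and the whole line
  close the chain, so that extreme rays are bracketed too.\<close>

lemma (in real_distribution) quantile_chain:
  assumes atom: "\<And>x. measure M {x} = 0" and m: "0 < m"
  shows "\<exists>S. (\<forall>i\<le>m. S i \<in> sets borel \<and> measure M (S i) = real i / real m) \<and>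
    (\<forall>B\<in>down_sets. \<exists>i<m. S i \<subseteq> B \<and> B \<subseteq> S (Suc i))"
proof -
  have "\<exists>x. cdf M x = real i / real m" if "0 < i" "i < m" for i
  proof -
    have p: "0 < real i / real m" "real i / real m < 1" using that by auto
    obtain a where a: "cdf M a < real i / real m"
      using order_tendstoD(2)[OF cdf_lim_at_bot p(1)] by (auto simp: eventually_at_bot_linorder)
    obtain b where b: "real i / real m < cdf M b"
      using order_tendstoD(1)[OF cdf_lim_at_top_prob p(2)] by (auto simp: eventually_at_top_linorder)
    have "a \<le> b" using cdf_nondecreasing[of b a] a b by linarith
    then show ?thesis
      using IVT[of "cdf M" a "real i / real m" b] a b atom by (auto simp: isCont_cdf)
  qed
  then obtain x where x: "\<And>i. 0 < i \<Longrightarrow> i < m \<Longrightarrow> cdf M (x i) = real i / real m" by metis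
  define S where "S i = (if i = 0 then {} else if i < m then {..x i} else UNIV)" for i
  have "S i \<in> sets borel \<and> measure M (S i) = real i / real m" if "i \<le> m" for i
    using that x[of i] m prob_space by (auto simp: S_def cdf_def2)
  moreover have "\<exists>i<m. S i \<subseteq> B \<and> B \<subseteq> S (Suc i)" if B: "B \<in> down_sets" for B
  proof -
    \<comment> \<open>Take the last member of the chain inside B. The next one is not inside B, and
      since rays are totally ordered by inclusion, it contains B.\<close>
    let ?I = "{i\<in>{..<m}. S i \<subseteq> B}"
    have "0 \<in> ?I" using m by (simp add: S_def)
    then have max: "Max ?I \<in> ?I" by (intro Max_in) auto
    have "B \<subseteq> S (Suc (Max ?I))"
    proof (cases "Suc (Max ?I) < m")
      case True
      have "Suc (Max ?I) \<notin> ?I" 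
      proof
        assume "Suc (Max ?I) \<in> ?I"
        then have "Suc (Max ?I) \<le> Max ?I" by (intro Max_ge) auto
        then show False by simp
      qed
      then have "\<not> {..x (Suc (Max ?I))} \<subseteq> B" using True by (simp add: S_def)
      then have "B \<subseteq> {..x (Suc (Max ?I))}" using B by (auto simp: down_sets_def)
      then show ?thesis using True by (simp add: S_def)
    qed (simp add: S_def)
    then show ?thesis using max by blast
  qed
  ultimately show ?thesis by blast
qed

text \<open>Both the empirical and the true measure are monotone, so the deviation at A \<times> B
  is controlled by the two bracketing rectangles together with the true mass between them.\<close>

lemma bracketing_deviation_le:
  fixes D :: "(real \<times> real) measure" and z :: "nat \<Rightarrow> real \<times> real"
  assumes D: "prob_space D" and sets: "sets D = sets borel" and m: "0 < m"
    and S: "\<And>i. i \<le> m \<Longrightarrow> S i \<in> sets borel" "\<And>i. i \<le> m \<Longrightarrow> measure D (S i \<times> UNIV) = real i / real m"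
    and T: "\<And>i. i \<le> m \<Longrightarrow> T i \<in> sets borel" "\<And>i. i \<le> m \<Longrightarrow> measure D (UNIV \<times> T i) = real i / real m"
    and A: "i < m" "S i \<subseteq> A" "A \<subseteq> S (Suc i)" "A \<in> sets borel"
    and B: "j < m" "T j \<subseteq> B" "B \<subseteq> T (Suc j)" "B \<in> sets borel"
    and dev: "\<And>i j. i \<le> m \<Longrightarrow> j \<le> m \<Longrightarrow>
      \<bar>real (card {k\<in>{..<n}. z k \<in> S i \<times> T j}) / real n - measure D (S i \<times> T j)\<bar> \<le> \<delta>"
  shows "\<bar>real (card {k\<in>{..<n}. z k \<in> A \<times> B}) / real n - measure D (A \<times> B)\<bar> \<le> \<delta> + 2 / real m"
proof -
  interpret prob_space D by (rule D)
  have meas: "U \<times> V \<in> events" if "U \<in> sets borel" "V \<in> sets borel" for U V :: "real set"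
    using that unfolding sets borel_prod[symmetric] by simp
  have e_mono: "real (card {k\<in>{..<n}. z k \<in> U}) / real n \<le> real (card {k\<in>{..<n}. z k \<in> V}) / real n"
    if "U \<subseteq> V" for U V
    using that by (intro divide_right_mono) (auto intro!: card_mono)
  let ?L = "S i \<times> T j" and ?U = "S (Suc i) \<times> T (Suc j)"
  have mS: "S i \<in> sets borel" "S (Suc i) \<in> sets borel" "T j \<in> sets borel" "T (Suc j) \<in> sets borel"
    using A B S T by auto
  have "prob (S (Suc i) \<times> UNIV - S i \<times> UNIV) = prob (S (Suc i) \<times> UNIV) - prob (S i \<times> UNIV)"
    using mS A by (intro finite_measure_Diff meas) auto
  then have 1: "prob (S (Suc i) \<times> UNIV - S i \<times> UNIV) = 1 / real m"
    using A S by (simp add: diff_divide_distrib[symmetric])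
  have "prob (UNIV \<times> T (Suc j) - UNIV \<times> T j) = prob (UNIV \<times> T (Suc j)) - prob (UNIV \<times> T j)"
    using mS B by (intro finite_measure_Diff meas) auto
  then have 2: "prob (UNIV \<times> T (Suc j) - UNIV \<times> T j) = 1 / real m"
    using B T by (simp add: diff_divide_distrib[symmetric])
  \<comment> \<open>What the outer rectangle adds to the inner one lies in a vertical and a
    horizontal strip, each of mass 1 / m.\<close>
  have "prob ?U \<le> prob (?L \<union> ((S (Suc i) \<times> UNIV - S i \<times> UNIV) \<union> (UNIV \<times> T (Suc j) - UNIV \<times> T j)))"
    using mS by (intro finite_measure_mono sets.Un sets.Diff meas) auto
  also have "\<dots> \<le> prob ?L + prob ((S (Suc i) \<times> UNIV - S i \<times> UNIV) \<union> (UNIV \<times> T (Suc j) - UNIV \<times> T j))"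
    using mS by (intro measure_Un_le sets.Un sets.Diff meas) auto
  also have "prob ((S (Suc i) \<times> UNIV - S i \<times> UNIV) \<union> (UNIV \<times> T (Suc j) - UNIV \<times> T j)) \<le>
      1 / real m + 1 / real m"
    unfolding 1[symmetric] using 2 mS
    by (intro order.trans[OF measure_Un_le] sets.Diff meas) (auto simp: 1)
  finally have gap: "prob ?U \<le> prob ?L + 2 / real m" by simp
  have "prob ?L \<le> prob (A \<times> B)" "prob (A \<times> B) \<le> prob ?U"
    using mS A B by (intro finite_measure_mono meas; auto)+
  moreover have "real (card {k\<in>{..<n}. z k \<in> ?L}) / real n \<le> real (card {k\<in>{..<n}. z k \<in> A \<times> B}) / real n"
    "real (card {k\<in>{..<n}. z k \<in> A \<times> B}) / real n \<le> real (card {k\<in>{..<n}. z k \<in> ?U}) / real n"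
    using A B by (intro e_mono; auto)+
  moreover have "\<bar>real (card {k\<in>{..<n}. z k \<in> ?L}) / real n - prob ?L\<bar> \<le> \<delta>"
    "\<bar>real (card {k\<in>{..<n}. z k \<in> ?U}) / real n - prob ?U\<bar> \<le> \<delta>"
    using A B by (intro dev; simp)+
  ultimately show ?thesis using gap unfolding abs_le_iff by linarith
qed

lemma (in prob_space) empirical_rectangles_rate:
  fixes Z :: "nat \<Rightarrow> 'a \<Rightarrow> real \<times> real"
  assumes indep: "indep_vars (\<lambda>_. borel) Z UNIV"
    and dist: "\<And>k. distr M borel (Z k) = D"
    and atoms: "\<And>x. measure D ({x} \<times> UNIV) = 0" "\<And>x. measure D (UNIV \<times> {x}) = 0"
    and r: "r < 1 / 2"
  shows "AE \<omega> in M. \<forall>\<^sub>F n in sequentially. \<forall>A\<in>down_sets. \<forall>B\<in>down_sets.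
    \<bar>real (card {k\<in>{..<n}. Z k \<omega> \<in> A \<times> B}) / real n - measure D (A \<times> B)\<bar> \<le>
      real n powr (- r) + 2 / real n"
proof -
  have rv [measurable]: "random_variable borel (Z k)" for k
    using indep by (auto simp: indep_vars_def)
  have sets_D: "sets D = sets borel" by (simp add: dist[of 0, symmetric])
  interpret D: prob_space D unfolding dist[of 0, symmetric] by (rule prob_space_distr) simp
  have fst_snd: "fst \<in> measurable D borel" "snd \<in> measurable D borel"
    by (simp_all add: measurable_cong_sets[OF sets_D refl] borel_measurable_continuous_onI
        continuous_on_fst continuous_on_snd continuous_on_id)
  have space_D: "space D = UNIV" using sets_eq_imp_space_eq[OF sets_D] by simp
  interpret D1: real_distribution "distr D borel fst" by (rule D.real_distribution_distr) (rule fst_snd)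
  interpret D2: real_distribution "distr D borel snd" by (rule D.real_distribution_distr) (rule fst_snd)
  have margin: "measure (distr D borel fst) U = measure D (U \<times> UNIV)"
    "measure (distr D borel snd) U = measure D (UNIV \<times> U)" if "U \<in> sets borel" for U
    using that by (simp_all add: measure_distr fst_snd space_D vimage_fst vimage_snd)
  have "\<exists>S. (\<forall>i\<le>Suc n. S i \<in> sets borel \<and> measure D (S i \<times> UNIV) = real i / real (Suc n)) \<and>
      (\<forall>B\<in>down_sets. \<exists>i<Suc n. S i \<subseteq> B \<and> B \<subseteq> S (Suc i))" for n
    using D1.quantile_chain[of "Suc n"] atoms(1) by (simp add: margin cong: conj_cong)
  then obtain S where S: "\<And>n i. i \<le> Suc n \<Longrightarrow> S n i \<in> sets borel"
      "\<And>n i. i \<le> Suc n \<Longrightarrow> measure D (S n i \<times> UNIV) = real i / real (Suc n)"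
      "\<And>n B. B \<in> down_sets \<Longrightarrow> \<exists>i<Suc n. S n i \<subseteq> B \<and> B \<subseteq> S n (Suc i)"
    by metis
  have "\<exists>S. (\<forall>i\<le>Suc n. S i \<in> sets borel \<and> measure D (UNIV \<times> S i) = real i / real (Suc n)) \<and>
      (\<forall>B\<in>down_sets. \<exists>i<Suc n. S i \<subseteq> B \<and> B \<subseteq> S (Suc i))" for n
    using D2.quantile_chain[of "Suc n"] atoms(2) by (simp add: margin cong: conj_cong)
  then obtain T where T: "\<And>n i. i \<le> Suc n \<Longrightarrow> T n i \<in> sets borel"
      "\<And>n i. i \<le> Suc n \<Longrightarrow> measure D (UNIV \<times> T n i) = real i / real (Suc n)"
      "\<And>n B. B \<in> down_sets \<Longrightarrow> \<exists>i<Suc n. T n i \<subseteq> B \<and> B \<subseteq> T n (Suc i)"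
    by metis
  define e where "e n \<omega> C = real (card {k\<in>{..<n}. Z k \<omega> \<in> C}) / real n" for n \<omega> C
  \<comment> \<open>Sample size and grid size are both \<open>Suc n\<close>, hence positive; the
    shift is undone at the very end. With as many quantile levels as observations the bracketing
    error is 2 / n, while the union bound has only quadratically many terms.\<close>
  define dev where "dev n i j = {\<omega>\<in>space M. real (Suc n) powr (- r) \<le>
      \<bar>e (Suc n) \<omega> (S n i \<times> T n j) - measure D (S n i \<times> T n j)\<bar>}" for n i j
  define bad where "bad n = (\<Union>(i, j)\<in>{..Suc n} \<times> {..Suc n}. dev n i j)" for n
  have ST: "S n i \<times> T n j \<in> sets borel" if "i \<le> Suc n" "j \<le> Suc n" for n i j
    using that S(1) T(1) unfolding borel_prod[symmetric] by simp
  have dev_sets: "dev n i j \<in> events" if "i \<le> Suc n" "j \<le> Suc n" for n i j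
  proof -
    have [measurable]: "S n i \<times> T n j \<in> sets borel" by (rule ST[OF that])
    show ?thesis unfolding dev_def e_def by measurable
  qed
  have bad_sets: "bad n \<in> events" for n
    unfolding bad_def by (intro sets.finite_UN) (auto intro: dev_sets)
  have bad_le: "prob (bad n) \<le> (real n + 2)\<^sup>2 * (2 * exp (- 2 * real (Suc n) powr (1 - 2 * r)))" for n
  proof -
    have "prob (bad n) \<le> (\<Sum>p\<in>{..Suc n} \<times> {..Suc n}. prob (case p of (i, j) \<Rightarrow> dev n i j))"
      unfolding bad_def by (intro finite_measure_subadditive_finite) (auto intro: dev_sets)
    also have "\<dots> \<le> (\<Sum>p\<in>{..Suc n} \<times> {..Suc n}. 2 * exp (- 2 * real (Suc n) powr (1 - 2 * r)))"
    proof (intro sum_mono)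
      fix p assume p: "p \<in> {..Suc n} \<times> {..Suc n}"
      obtain i j where ij: "p = (i, j)" by (cases p)
      have "prob (dev n i j) \<le> 2 * exp (- 2 * real (Suc n) * (real (Suc n) powr (- r))\<^sup>2)"
        unfolding dev_def e_def using p ij
        by (intro empirical_measure_Hoeffding[OF indep dist] ST) auto
      also have "real (Suc n) * (real (Suc n) powr (- r))\<^sup>2 = real (Suc n) powr (1 - 2 * r)"
        by (simp add: powr_power powr_mult_base)
      then have "- 2 * real (Suc n) * (real (Suc n) powr (- r))\<^sup>2 = - 2 * real (Suc n) powr (1 - 2 * r)"
        by (simp only: mult.assoc)
      finally show "prob (case p of (i, j) \<Rightarrow> dev n i j) \<le> 2 * exp (- 2 * real (Suc n) powr (1 - 2 * r))"
        by (simp add: ij)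
    qed
    also have "\<dots> = (real n + 2)\<^sup>2 * (2 * exp (- 2 * real (Suc n) powr (1 - 2 * r)))"
    proof -
      have "real (card ({..Suc n} \<times> {..Suc n})) = (real n + 2)\<^sup>2"
        by (simp add: power2_eq_square algebra_simps)
      then show ?thesis by (simp only: sum_constant)
    qed
    finally show ?thesis .
  qed
  have "summable (\<lambda>n. prob (bad n))"
  proof (rule summable_comparison_test_bigo)
    show "summable (\<lambda>n. norm (real n powr (- 2)))" by (simp add: summable_real_powr_iff)
    \<comment> \<open>Squaring \<open>n powr (- r)\<close> in Hoeffding's bound gives the exponent
      \<open>n powr (1 - 2 * r)\<close>. Its growth requires r < 1/2 and makes the exponential beat
      the number of grid pairs.\<close>
    have c: "0 < 1 - 2 * r" using r by simp
    have "(\<lambda>n. prob (bad n)) \<in> O(\<lambda>n. (real n + 2)\<^sup>2 * (2 * exp (- 2 * real (Suc n) powr (1 - 2 * r))))"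
      using bad_le by (intro bigoI[of _ 1]) (auto intro!: always_eventually)
    also have "(\<lambda>n. (real n + 2)\<^sup>2 * (2 * exp (- 2 * real (Suc n) powr (1 - 2 * r)))) \<in> O(\<lambda>n. real n powr (- 2))"
      using c by real_asymp
    finally show "(\<lambda>n. prob (bad n)) \<in> O(\<lambda>n. real n powr (- 2))" .
  qed
  then have "AE \<omega> in M. \<forall>\<^sub>F n in sequentially. \<omega> \<in> space M - bad n"
    by (intro borel_cantelli_AE1 bad_sets) (auto simp: emeasure_eq_measure)
  then show ?thesis
  proof eventually_elim
    case (elim \<omega>)
    then have "\<forall>\<^sub>F n in sequentially. \<forall>A\<in>down_sets. \<forall>B\<in>down_sets.
        \<bar>e (Suc n) \<omega> (A \<times> B) - measure D (A \<times> B)\<bar> \<le> real (Suc n) powr (- r) + 2 / real (Suc n)"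
    proof eventually_elim
      case (elim n)
      have dev_le: "\<bar>e (Suc n) \<omega> (S n i \<times> T n j) - measure D (S n i \<times> T n j)\<bar> \<le> real (Suc n) powr (- r)"
        if "i \<le> Suc n" "j \<le> Suc n" for i j
        using elim that by (auto simp: bad_def dev_def not_le intro: less_imp_le)
      show ?case
      proof (intro ballI)
        fix A B assume A: "A \<in> down_sets" and B: "B \<in> down_sets"
        have AB: "A \<in> sets borel" "B \<in> sets borel" using A B by (auto simp: down_sets_def)
        obtain i where i: "i < Suc n" "S n i \<subseteq> A" "A \<subseteq> S n (Suc i)" using S(3)[OF A] by blast
        obtain j where j: "j < Suc n" "T n j \<subseteq> B" "B \<subseteq> T n (Suc j)" using T(3)[OF B] by blast
        show "\<bar>e (Suc n) \<omega> (A \<times> B) - measure D (A \<times> B)\<bar> \<le> real (Suc n) powr (- r) + 2 / real (Suc n)"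
          unfolding e_def
          by (rule bracketing_deviation_le[of D "Suc n" "S n" "T n" i A j B, OF D.prob_space_axioms sets_D _ S(1,2) T(1,2) i AB(1) j AB(2)])
            (use dev_le in \<open>simp_all add: e_def\<close>)
      qed
    qed
    then show ?case unfolding e_def
      by (subst (asm) eventually_sequentially_Suc[where P="\<lambda>n. \<forall>A\<in>down_sets. \<forall>B\<in>down_sets.
        \<bar>real (card {k\<in>{..<n}. Z k \<omega> \<in> A \<times> B}) / real n - measure D (A \<times> B)\<bar> \<le> real n powr (- r) + 2 / real n"])
  qed
qed

section \<open>Convergence\<close>

text \<open>A real supremum is informative only for families bounded above. The eventual uniform
  bound provides this as well; halving it gives the strict inequality, and any single absolute value
  shows that the supremum is nonnegative.\<close>

lemma SUP_abs_tendsto_0: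
  fixes f :: "nat \<Rightarrow> 'b \<Rightarrow> 'c \<Rightarrow> real"
  assumes "\<And>\<epsilon>. 0 < \<epsilon> \<Longrightarrow> \<forall>\<^sub>F n in sequentially. \<forall>x y. \<bar>f n x y\<bar> \<le> \<epsilon>"
  shows "(\<lambda>n. SUP (x, y)\<in>UNIV. \<bar>f n x y\<bar>) \<longlonglongrightarrow> 0"
proof (rule tendstoI)
  fix \<epsilon> :: real assume "0 < \<epsilon>"
  then have "\<forall>\<^sub>F n in sequentially. \<forall>x y. \<bar>f n x y\<bar> \<le> \<epsilon> / 2" by (intro assms) simp
  then show "\<forall>\<^sub>F n in sequentially. dist (SUP (x, y)\<in>UNIV. \<bar>f n x y\<bar>) 0 < \<epsilon>"
  proof eventually_elim
    case (elim n)
    have "(SUP (x, y)\<in>UNIV. \<bar>f n x y\<bar>) \<le> \<epsilon> / 2"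
      using elim by (intro cSUP_least) auto
    moreover have "bdd_above ((\<lambda>(x, y). \<bar>f n x y\<bar>) ` UNIV)"
      using elim by (intro bdd_aboveI[of _ "\<epsilon> / 2"]) auto
    then have "\<bar>f n undefined undefined\<bar> \<le> (SUP (x, y)\<in>UNIV. \<bar>f n x y\<bar>)"
      using cSUP_upper[of "(undefined, undefined)" UNIV "\<lambda>(x, y). \<bar>f n x y\<bar>"] by simp
    ultimately show ?case using \<open>0 < \<epsilon>\<close> by (simp add: dist_real_def)
  qed
qed

text \<open>This concerns one fixed sample path: all probability is contained in the absence of ties
  and in the assumed rate. Each of the three parts of the error receives
  \<open>\<epsilon> / 3\<close>.\<close>

lemma bernstein_kernel_emp_copula_uniform:
  assumes K: "continuous_markov_kernel_of A K"
    and X: "inj (\<lambda>k. X k \<omega>)" and Y: "inj (\<lambda>k. Y k \<omega>)"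
    and F: "\<And>x. F x \<in> {0..1}" and G: "\<And>y. G y \<in> {0..1}"
    and s: "0 < s" "s < r" "r < 1"
    and rate: "\<forall>\<^sub>F n in sequentially. \<forall>x y.
      \<bar>emp_cdf X n \<omega> x - F x\<bar> \<le> real n powr (- r) + 2 / real n \<and>
      \<bar>emp_cdf Y n \<omega> y - G y\<bar> \<le> real n powr (- r) + 2 / real n \<and>
      \<bar>emp_joint X Y n \<omega> x y - A (F x) (G y)\<bar> \<le> real n powr (- r) + 2 / real n"
  shows "(\<lambda>n. SUP (x, y)\<in>UNIV.
      \<bar>bernstein_kernel (nat \<lfloor>real n powr s\<rfloor>) (emp_copula X Y n \<omega>) (emp_cdf X n \<omega> x) (emp_cdf Y n \<omega> y)
       - measure (K (F x)) {0..G y}\<bar>) \<longlonglongrightarrow> 0"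
proof (rule SUP_abs_tendsto_0)
  fix \<epsilon> :: real assume \<epsilon>: "0 < \<epsilon>"
  define k where "k x y = measure (K x) {0..y}" for x y
  define d where "d n = real n powr (- r) + 2 / real n" for n
  define N where "N n = nat \<lfloor>real n powr s\<rfloor>" for n
  obtain \<mu> where \<mu>: "doubly_stochastic_measure_of A \<mu>"
    using K unfolding continuous_markov_kernel_of_def markov_kernel_of_def by blast
  have cont: "continuous_on ({0..1} \<times> {0..1}) (\<lambda>(x, y). k x y)"
    using K by (simp add: continuous_markov_kernel_of_def k_def)
  obtain \<delta> where \<delta>: "0 < \<delta>"
    and uc: "\<And>x y x' y'. x \<in> {0..1} \<Longrightarrow> y \<in> {0..1} \<Longrightarrow> x' \<in> {0..1} \<Longrightarrow> y' \<in> {0..1} \<Longrightarrow>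
      \<bar>x - x'\<bar> < \<delta> \<Longrightarrow> \<bar>y - y'\<bar> < \<delta> \<Longrightarrow> \<bar>k x y - k x' y'\<bar> \<le> \<epsilon> / 3"
    using uniformly_continuous_on_square[OF cont, of "\<epsilon> / 3"] \<epsilon> by auto
  obtain N0 where N0: "\<And>N u v. N0 \<le> N \<Longrightarrow> u \<in> {0..1} \<Longrightarrow> v \<in> {0..1} \<Longrightarrow>
      \<bar>bernstein_kernel N A u v - k u v\<bar> \<le> \<epsilon> / 3"
    using bernstein_kernel_copula_uniform[OF K, of "\<epsilon> / 3"] \<epsilon> unfolding k_def
    by (meson divide_pos_pos zero_less_numeral)
  have "d \<longlonglongrightarrow> 0" unfolding d_def using s by real_asymp
  then have ev_d: "\<forall>\<^sub>F n in sequentially. d n < \<delta>"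
    using \<delta> by (rule order_tendstoD(2))
  \<comment> \<open>Up to constants the terms are \<open>n powr (s - r)\<close> and
    \<open>n powr (s - 1)\<close>, both vanishing because s < r < 1.\<close>
  have "(\<lambda>n. 2 * real n powr s * (3 * d n + 2 / real n)) \<longlonglongrightarrow> 0"
    unfolding d_def using s by real_asymp
  then have ev_err: "\<forall>\<^sub>F n in sequentially. 2 * real n powr s * (3 * d n + 2 / real n) < \<epsilon> / 3"
    using \<epsilon> by (intro order_tendstoD(2)) auto
  have "filterlim (\<lambda>n. real n powr s) at_top sequentially" using s by real_asymp
  \<comment> \<open>Asking for \<open>Suc N0\<close> makes the integer part both at least
    \<open>N0\<close> and positive.\<close>
  then have ev_N: "\<forall>\<^sub>F n in sequentially. real (Suc N0) \<le> real n powr s"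
    by (simp add: filterlim_at_top)
  show "\<forall>\<^sub>F n in sequentially. \<forall>x y.
      \<bar>bernstein_kernel (nat \<lfloor>real n powr s\<rfloor>) (emp_copula X Y n \<omega>) (emp_cdf X n \<omega> x) (emp_cdf Y n \<omega> y)
       - measure (K (F x)) {0..G y}\<bar> \<le> \<epsilon>"
    using rate ev_d ev_err ev_N eventually_gt_at_top[of 0]
  proof eventually_elim
    case (elim n)
    have n: "0 < n" using elim by simp
    have Nn: "N0 \<le> N n" "0 < N n" "real (N n) \<le> real n powr s"
      using elim(4) unfolding N_def by linarith+
    have dX: "\<bar>emp_cdf X n \<omega> x - F x\<bar> \<le> d n" and dY: "\<bar>emp_cdf Y n \<omega> x - G x\<bar> \<le> d n"
      and dH: "\<bar>emp_joint X Y n \<omega> x y - A (F x) (G y)\<bar> \<le> d n" for x y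
      using elim(1) by (auto simp: d_def)
    have cdf01: "emp_cdf Z n \<omega> x \<in> {0..1}" for Z :: "nat \<Rightarrow> 'a \<Rightarrow> real" and x
      using count_le[of n "\<lambda>k. Z k \<omega> \<le> x"] n by (auto simp: emp_cdf_def divide_simps)
    have E: "\<bar>emp_copula X Y n \<omega> u v - A u v\<bar> \<le> 3 * d n + 2 / real n"
      if "u \<in> {0..1}" "v \<in> {0..1}" for u v
      by (rule emp_copula_diff_le[of n X \<omega> Y u v A F "d n" G])
        (use n that F G dX dY dH in \<open>auto intro!: copula_lipschitz[OF \<mu>] inj_on_subset[OF X] inj_on_subset[OF Y]\<close>)
    show ?case
    proof (intro allI)
      fix x y
      let ?u = "emp_cdf X n \<omega> x" and ?v = "emp_cdf Y n \<omega> y"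
      have "\<bar>bernstein_kernel (N n) (emp_copula X Y n \<omega>) ?u ?v - bernstein_kernel (N n) A ?u ?v\<bar> \<le>
          2 * real (N n) * (3 * d n + 2 / real n)"
        using Nn(2) by (intro bernstein_kernel_diff_le cdf01 E) auto
      also have "\<dots> \<le> 2 * real n powr s * (3 * d n + 2 / real n)"
        using Nn(3) by (intro mult_right_mono) (auto simp: d_def)
      finally have "\<bar>bernstein_kernel (N n) (emp_copula X Y n \<omega>) ?u ?v - bernstein_kernel (N n) A ?u ?v\<bar> \<le> \<epsilon> / 3"
        using elim(3) by linarith
      moreover have "\<bar>bernstein_kernel (N n) A ?u ?v - k ?u ?v\<bar> \<le> \<epsilon> / 3"
        using Nn(1) by (intro N0 cdf01)
      moreover have "\<bar>k ?u ?v - k (F x) (G y)\<bar> \<le> \<epsilon> / 3"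
        using dX[of x] dY[of y] elim(2) by (intro uc cdf01 F G) linarith+
      ultimately show "\<bar>bernstein_kernel (nat \<lfloor>real n powr s\<rfloor>) (emp_copula X Y n \<omega>) ?u ?v
          - measure (K (F x)) {0..G y}\<bar> \<le> \<epsilon>"
        unfolding N_def[symmetric] k_def[symmetric] by linarith
    qed
  qed
qed

section \<open>Assembly for the random sample\<close>

theorem theorem4p3:
  fixes M :: "'a measure" and X Y :: "nat \<Rightarrow> 'a \<Rightarrow> real"
    and H :: "real \<Rightarrow> real \<Rightarrow> real" and F G :: "real \<Rightarrow> real"
    and A :: "real \<Rightarrow> real \<Rightarrow> real" and K :: "real \<Rightarrow> real measure" and s :: real
  assumes "prob_space M"
    and "\<And>k. X k \<in> borel_measurable M" and "\<And>k. Y k \<in> borel_measurable M"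
    and "prob_space.indep_vars M (\<lambda>_. borel) (\<lambda>k \<omega>. (X k \<omega>, Y k \<omega>)) UNIV"
    and "\<And>k. distr M borel (\<lambda>\<omega>. (X k \<omega>, Y k \<omega>)) = distr M borel (\<lambda>\<omega>. (X 0 \<omega>, Y 0 \<omega>))"
    and "\<And>x y. H x y = measure M {\<omega>\<in>space M. X 0 \<omega> \<le> x \<and> Y 0 \<omega> \<le> y}"
    and "\<And>x. F x = measure M {\<omega>\<in>space M. X 0 \<omega> \<le> x}"
    and "\<And>y. G y = measure M {\<omega>\<in>space M. Y 0 \<omega> \<le> y}"
    and "continuous_on UNIV (\<lambda>(x, y). H x y)"
    and "copula A" and "\<And>x y. H x y = A (F x) (G y)"
    and "continuous_markov_kernel_of A K"
    and "0 < s" and "s < 1 / 2"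
  shows "AE \<omega> in M.
    (\<lambda>n. SUP (x, y)\<in>UNIV.
        \<bar>bernstein_kernel (nat \<lfloor>real n powr s\<rfloor>) (emp_copula X Y n \<omega>)
            (emp_cdf X n \<omega> x) (emp_cdf Y n \<omega> y)
         - measure (K (F x)) {0..G y}\<bar>) \<longlonglongrightarrow> 0"
proof -
  interpret prob_space M by fact
  note [measurable] = assms(2,3)
  note indep = assms(4) and dist = assms(5) and H = assms(6) and F = assms(7) and G = assms(8)
    and cont = assms(9)
  \<comment> \<open>All pairs share the law D. Atoms are excluded for the first pair, transferred to
    D, and from there to every index.\<close>
  define D where "D = distr M borel (\<lambda>\<omega>. (X 0 \<omega>, Y 0 \<omega>))"
  have D: "measure D C = prob {\<omega>\<in>space M. (X k \<omega>, Y k \<omega>) \<in> C}" if "C \<in> sets borel" for C k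
  proof -
    have "D = distr M borel (\<lambda>\<omega>. (X k \<omega>, Y k \<omega>))" by (simp only: D_def dist[of k])
    moreover have "(\<lambda>\<omega>. (X k \<omega>, Y k \<omega>)) -` C \<inter> space M = {\<omega>\<in>space M. (X k \<omega>, Y k \<omega>) \<in> C}" by auto
    ultimately show ?thesis using that by (simp add: measure_distr)
  qed
  have rect: "U \<times> V \<in> sets borel" if "U \<in> sets borel" "V \<in> sets borel" for U V :: "real set"
    using that unfolding borel_prod[symmetric] by simp
  \<comment> \<open>With the coordinates exchanged, the no-atom argument applies to Y as
    well.\<close>
  have cont': "continuous_on UNIV (\<lambda>(y, x). H x y)"
  proof -
    have "continuous_on UNIV ((\<lambda>(x, y). H x y) \<circ> (\<lambda>p. (snd p, fst p)))"
      by (intro continuous_on_compose continuous_on_subset[OF cont] continuous_intros) auto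
    then show ?thesis by (simp add: o_def case_prod_unfold)
  qed
  have "prob {\<omega>\<in>space M. X 0 \<omega> = x} = 0" for x
    by (rule continuous_joint_cdf_no_atom[OF assms(2,3) H cont])
  then have atomX: "measure D ({x} \<times> UNIV) = 0" for x
    by (subst D[of _ 0]) (auto intro: rect)
  have "prob {\<omega>\<in>space M. Y 0 \<omega> = y} = 0" for y
    by (rule continuous_joint_cdf_no_atom[OF assms(3,2) _ cont']) (simp add: H conj_commute)
  then have atomY: "measure D (UNIV \<times> {y}) = 0" for y
    by (subst D[of _ 0]) (auto intro: rect)
  have injX: "AE \<omega> in M. inj (\<lambda>k. X k \<omega>)"
  proof (rule AE_inj_sample)
    show "indep_vars (\<lambda>_. borel) X UNIV"
      using indep_vars_compose2[OF indep, of "\<lambda>_. fst" "\<lambda>_. borel"] by (simp add: borel_measurable_continuous_onI continuous_on_fst continuous_on_id)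
    show "prob {\<omega>\<in>space M. X k \<omega> = x} = 0" for k x
      using atomX[of x] by (subst (asm) D[of _ k]) (auto intro: rect)
  qed
  have injY: "AE \<omega> in M. inj (\<lambda>k. Y k \<omega>)"
  proof (rule AE_inj_sample)
    show "indep_vars (\<lambda>_. borel) Y UNIV"
      using indep_vars_compose2[OF indep, of "\<lambda>_. snd" "\<lambda>_. borel"] by (simp add: borel_measurable_continuous_onI continuous_on_snd continuous_on_id)
    show "prob {\<omega>\<in>space M. Y k \<omega> = x} = 0" for k x
      using atomY[of x] by (subst (asm) D[of _ k]) (auto intro: rect)
  qed
  \<comment> \<open>Any exponent strictly between s and 1/2 serves; this is the midpoint.\<close>
  define r where "r = (s + 1 / 2) / 2"
  have r: "s < r" "r < 1 / 2" using assms(13,14) by (auto simp: r_def)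
  have D_down: "measure D ({..x} \<times> {..y}) = A (F x) (G y)" "measure D ({..x} \<times> UNIV) = F x"
    "measure D (UNIV \<times> {..y}) = G y" for x y
  proof -
    have "measure D ({..x} \<times> {..y}) = H x y"
      by (subst D[of _ 0]) (auto intro: rect simp: H)
    then show "measure D ({..x} \<times> {..y}) = A (F x) (G y)" by (simp only: assms(11))
    show "measure D ({..x} \<times> UNIV) = F x" "measure D (UNIV \<times> {..y}) = G y"
      by (subst D[of _ 0]; auto intro: rect simp: F G)+
  qed
  have "AE \<omega> in M. \<forall>\<^sub>F n in sequentially. \<forall>B\<in>down_sets. \<forall>C\<in>down_sets.
      \<bar>real (card {k\<in>{..<n}. (X k \<omega>, Y k \<omega>) \<in> B \<times> C}) / real n - measure D (B \<times> C)\<bar> \<le>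
      real n powr (- r) + 2 / real n"
    using dist atomX atomY r(2) by (intro empirical_rectangles_rate[OF indep]) (auto simp: D_def)
  then show ?thesis using injX injY
  proof eventually_elim
    case (elim \<omega>)
    have rate: "\<forall>\<^sub>F n in sequentially. \<forall>x y.
      \<bar>emp_cdf X n \<omega> x - F x\<bar> \<le> real n powr (- r) + 2 / real n \<and>
      \<bar>emp_cdf Y n \<omega> y - G y\<bar> \<le> real n powr (- r) + 2 / real n \<and>
      \<bar>emp_joint X Y n \<omega> x y - A (F x) (G y)\<bar> \<le> real n powr (- r) + 2 / real n"
      using elim(1)
    proof eventually_elim
      case (elim n)
      have down: "{..x} \<in> down_sets" "UNIV \<in> down_sets" for x by (auto simp: down_sets_def)
      show ?case
        using elim[rule_format, OF down(1) down(2)] elim[rule_format, OF down(2) down(1)]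
          elim[rule_format, OF down(1) down(1)]
        unfolding D_down by (simp add: emp_cdf_def emp_joint_def)
    qed
    show ?case
    proof (rule bernstein_kernel_emp_copula_uniform[of A K X \<omega> Y F G s r, OF assms(12) elim(2,3)])
      show "F x \<in> {0..1}" "G x \<in> {0..1}" for x by (simp_all add: F G)
      show "s < r" "0 < s" "r < 1" using assms(13) r by auto
    qed (rule rate)
  qed
qed

end
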